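(* Let $R$ be a factorial domain, $K$ a field of quotients of $R$, $X$ an indeterminate over $K$ and $f\in R[X]^{\bullet}$. Set $r=|\{P\in\mathfrak{X}([\![f]\!])\mid P\cap R\neq\emptyset\}|-|\{u[\![f]\!]\mid u\in\mathcal{A}([\![f]\!])\cap R\}|$. Then $\mathcal{C}_v([\![f]\!])\cong\mathbb{Z}^r$, $$|\{[P]\mid P\in\mathfrak{X}([\![f]\!])\}|\geq|\{P\in\mathfrak{X}([\![f]\!])\mid P\cap R\neq\emptyset,\ P\text{ is not principal}\}|,$$ and the following are equivalent: (1) $[\![f]\!]$ is factorial. (2) $\mathcal{C}_v([\![f]\!])$ is finite. (3) $d(gh)=d(g)d(h)$ for all $g,h\in[\![f]\!]$.
   Context: Monoids are commutative and cancellative with identity; for a domain $D$, $D^{\bullet}=D\setminus\{0\}$ is regarded as a multiplicative monoid. For a monoid $H$ with quotient group $L$: $H^{\times}$ is the group of units, $\mathcal{A}(H)$ the set of atoms (irreducible elements). An $s$-ideal is a subset $I\subseteq H$ with $IH=I$ (the empty set is allowed); it is prime if $I\neq H$ and $H\setminus I$ is a submonoid. $\mathfrak{X}(H)$ is the set of minimal nonempty prime $s$-ideals of $H$ (height-one prime ideals). For $Y\subseteq L$ put $Y^{-1}=\{z\in L\mid zY\subseteq H\}$ and $Y_v=(Y^{-1})^{-1}$; $I\subseteq H$ is divisorial (a $v$-ideal) if $I_v=I$. $H$ is a Krull monoid if it is a completely integrally closed Mori monoid, equivalently every nonempty $v$-ideal is a finite $v$-product of height-one prime ideals, where the $v$-product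 of $I,J$ is $(IJ)_v$. For a Krull monoid $H$, the divisor-class group $\mathcal{C}_v(H)$ is the group of nonempty fractional $v$-ideals under $v$-multiplication modulo the subgroup of principal fractional ideals $xH$ ($x\in L$); $[I]$ denotes the class of $I$. $H$ is factorial if every nonunit is a product of prime elements. ${\rm Int}(R)=\{g\in K[X]\mid g(x)\in R\text{ for all }x\in R\}$. For $f\in{\rm Int}(R)^{\bullet}$, $[\![f]\!]=\{g\in{\rm Int}(R)^{\bullet}\mid g\text{ divides }f^k\text{ in }{\rm Int}(R)\text{ for some }k\in\mathbb{N}_0\}$, a submonoid of ${\rm Int}(R)^{\bullet}$; it is known that $[\![f]\!]$ is a Krull monoid and that $\mathfrak{X}([\![f]\!])$ and $\{u[\![f]\!]\mid u\in\mathcal{A}([\![f]\!])\}$ are finite. Fix a system $\mathcal{Q}$ of representatives (up to associates) of the prime elements of $R$; for $p\in\mathcal{Q}$, $\mathrm{v}_p:R\to\mathbb{N}_0\cup\{\infty\}$ is the $p$-adic valuation, and $d:{\rm Int}(R)^{\bullet}\to R^{\bullet}$ is defined by $d(g)=\prod_{p\in\mathcal{Q}}p^{\min\{\mathrm{v}_p(g(c))\mid c\in R\}}$. *)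

theory Defs
  imports
    "HOL-Algebra.Divisibility"
    "HOL-Algebra.Product_Groups"
    "HOL-Library.Set_Algebras"
    "HOL-Library.Extended_Nat"
    "HOL-Computational_Algebra.Polynomial_Factorial"
begin

section \<open>Multiplicative submonoids of a domain\<close>

text \<open>
  A (commutative, cancellative) monoid is a set \<open>H\<close> of nonzero elements of a domain \<open>'m\<close>
  that contains \<open>1\<close> and is closed under multiplication; its quotient group then lives
  inside the field \<open>'m fract\<close>. Products \<open>I * J\<close> and \<open>x *o I\<close> of sets are elementwise.
\<close>

definition submon :: "'m::comm_monoid_mult set \<Rightarrow> 'm monoid" where
  "submon H = \<lparr>carrier = H, monoid.mult = (*), one = 1\<rparr>"

definition atoms :: "'m::comm_monoid_mult set \<Rightarrow> 'm set" where
  "atoms H = {a \<in> H. Divisibility.irreducible (submon H) a}"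

definition factorial :: "'m::comm_monoid_mult set \<Rightarrow> bool" where
  "factorial H \<longleftrightarrow>
     (\<forall>a \<in> H - Units (submon H).
        \<exists>ps. set ps \<subseteq> H \<and> (\<forall>p \<in> set ps. Divisibility.prime (submon H) p) \<and> a = prod_list ps)"

definition s_ideal :: "'m::comm_monoid_mult set \<Rightarrow> 'm set \<Rightarrow> bool" where
  "s_ideal H I \<longleftrightarrow> I \<subseteq> H \<and> I * H = I"

definition prime_s_ideal :: "'m::comm_monoid_mult set \<Rightarrow> 'm set \<Rightarrow> bool" where
  "prime_s_ideal H P \<longleftrightarrow> s_ideal H P \<and> P \<noteq> H \<and> submonoid (H - P) (submon H)"

definition height_one_primes :: "'m::comm_monoid_mult set \<Rightarrow> 'm set set" where
  "height_one_primes H =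
     {P. prime_s_ideal H P \<and> P \<noteq> {} \<and>
         (\<forall>P'. prime_s_ideal H P' \<and> P' \<noteq> {} \<and> P' \<subseteq> P \<longrightarrow> P' = P)}"

definition principal_ideal :: "'m::comm_monoid_mult set \<Rightarrow> 'm set \<Rightarrow> bool" where
  "principal_ideal H I \<longleftrightarrow> (\<exists>x \<in> H. I = x *o H)"


section \<open>Fractional divisorial ideals and the divisor-class group\<close>

definition quot_group :: "'m::idom set \<Rightarrow> 'm fract set" where
  "quot_group H = {to_fract a / to_fract b | a b. a \<in> H \<and> b \<in> H}"

definition v_inv :: "'m::idom set \<Rightarrow> 'm fract set \<Rightarrow> 'm fract set" where
  "v_inv H Y = {z \<in> quot_group H. z *o Y \<subseteq> to_fract ` H}"

definition v_closure :: "'m::idom set \<Rightarrow> 'm fract set \<Rightarrow> 'm fract set" where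
  "v_closure H Y = v_inv H (v_inv H Y)"

text \<open>
  The condition with the denominator \<open>x\<close> makes \<open>I\<close> fractional; without it the whole quotient
  group, whose \<open>v_inv\<close> is empty unless it equals \<open>H\<close>, would count as a \<open>v\<close>-ideal.
\<close>

definition frac_v_ideals :: "'m::idom set \<Rightarrow> 'm fract set set" where
  "frac_v_ideals H =
     {I. I \<subseteq> quot_group H \<and> I \<noteq> {} \<and> (\<exists>x \<in> H. to_fract x *o I \<subseteq> to_fract ` H) \<and>
         v_closure H I = I}"

definition v_ideal_group :: "'m::idom set \<Rightarrow> 'm fract set monoid" where
  "v_ideal_group H =
     \<lparr>carrier = frac_v_ideals H,
      monoid.mult = (\<lambda>I J. v_closure H (I * J)),
      one = to_fract ` H\<rparr>"

definition principal_frac_ideals :: "'m::idom set \<Rightarrow> 'm fract set set" where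
  "principal_frac_ideals H = (\<lambda>x. x *o (to_fract ` H)) ` quot_group H"

definition class_group :: "'m::idom set \<Rightarrow> 'm fract set set monoid" where
  "class_group H = v_ideal_group H Mod principal_frac_ideals H"

definition ideal_class :: "'m::idom set \<Rightarrow> 'm set \<Rightarrow> 'm fract set set" where
  "ideal_class H I = principal_frac_ideals H #>\<^bsub>v_ideal_group H\<^esub> (to_fract ` I)"

definition int_power_group :: "nat \<Rightarrow> (nat \<Rightarrow> int) monoid" where
  "int_power_group n = product_group {..<n} (\<lambda>_. integer_group)"


section \<open>Integer-valued polynomials\<close>

definition int_valued :: "'a::idom fract poly set" where
  "int_valued = {g. \<forall>c. poly g (to_fract c) \<in> range to_fract}"

definition const_polys :: "'a::idom fract poly set" where
  "const_polys = range (\<lambda>c. [:to_fract c:])"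

definition monadic :: "'a::idom fract poly \<Rightarrow> 'a fract poly set" where
  "monadic f =
     {g \<in> int_valued - {0}. \<exists>k::nat. \<exists>h \<in> int_valued. f ^ k = g * h}"

definition prime_representatives :: "'a::comm_semiring_1 set \<Rightarrow> bool" where
  "prime_representatives Q \<longleftrightarrow>
     Q \<subseteq> {p. prime_elem p} \<and>
     (\<forall>p. prime_elem p \<longrightarrow> (\<exists>!q. q \<in> Q \<and> p dvd q \<and> q dvd p))"

text \<open>The library's \<open>multiplicity p 0\<close> is \<open>0\<close>, but the valuation of \<open>0\<close> is \<open>\<infinity>\<close>.\<close>

definition valuation :: "'a::factorial_semiring \<Rightarrow> 'a \<Rightarrow> enat" where
  "valuation p x = (if x = 0 then \<infinity> else enat (Factorial_Ring.multiplicity p x))"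

definition min_valuation :: "'a::{factorial_semiring, idom} \<Rightarrow> 'a fract poly \<Rightarrow> enat" where
  "min_valuation p g = (INF c. valuation p (the_inv to_fract (poly g (to_fract c))))"

text \<open>
  For nonzero integer-valued \<open>g\<close> and \<open>p \<in> Q\<close> the minimum is finite, and only finitely many
  \<open>p \<in> Q\<close> have a nonzero exponent; the product runs over these, since a product over an
  infinite index set would be \<open>1\<close>.
\<close>

definition fixed_divisor ::
    "'a::{factorial_semiring, idom} set \<Rightarrow> 'a fract poly \<Rightarrow> 'a" where
  "fixed_divisor Q g =
     (\<Prod>p \<in> {p \<in> Q. min_valuation p g \<noteq> 0}. p ^ the_enat (min_valuation p g))"

end

theory Submission
  imports Defs
begin

text \<open>
  Write \<open>f = c0 * q1 ^ a1 * \<dots> * qn ^ an\<close> with primitive, pairwise non-associated \<open>qi\<close> that are prime over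
  the quotient field. Up to units of \<open>R\<close>, the elements of \<open>H\<close> are the products
  \<open>\<Prod>p. p ^ m p * \<Prod>i. qi ^ ki\<close>, where \<open>p\<close> runs over the finitely many primes dividing every value
  of \<open>f\<close>, subject to \<open>ki \<ge> 0\<close> and \<open>m p + (\<Sum>i. ki * v_p (qi c)) \<ge> 0\<close> for all \<open>c\<close> with \<open>f c \<noteq> 0\<close>.
  By Dickson's lemma finitely many \<open>c\<close> suffice for each \<open>p\<close>. An irredundant system of these
  inequalities gives the facets of a rational cone, the height-one primes correspond to the facets,
  and the class group is the cokernel of the map sending an element of the quotient group to its values
  on the facets. The coefficient of \<open>m p\<close> is \<open>1\<close> in every facet belonging to \<open>p\<close>, so the
  cokernel is free, with one relation for each \<open>p\<close>. Finally, the exponent of \<open>p\<close> in \<open>d g\<close> is the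
  minimum over the facets belonging to \<open>p\<close>, and this minimum is additive only if there is just one.
\<close>

section \<open>Monoids cut out by finitely many facets\<close>

text \<open>No Krull theory is invoked. Once a monoid is given by facet valuations, its nonempty
  fractional v-ideals are exactly the sets \<open>div_ideal a\<close> for integer vectors
  \<open>a\<close>, with the v-product turned into addition, so the class group is computed
  directly. The obstacle on the polynomial side is the roots of f: some factor vanishes there, and
  no linear inequality on the exponents arises. All inequalities are therefore taken on
  \<open>nonroots\<close>. This loses nothing: a prime element p has infinitely many distinct
  powers, whereas f has finitely many roots, so \<open>nonroots\<close> is p-adically dense, and
  integrality on it implies integrality everywhere. Irredundance is obtained from a sufficient set
  of least cardinality. Each of its members is then the strict minimizer for some exponent vector,
  and this vector can be made positive in all coordinates, so that the resulting element of H lies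
  on one facet only, including the facets given by vanishing exponents. The exponents of the
  polynomial factors are free in the quotient group. Hence their facets, whose height-one primes
  contain no constants, do not contribute to the rank.\<close>

locale domain_submonoid =
  fixes H :: "'m::idom set"
  assumes zero_notin [simp]: "0 \<notin> H"
    and one_in [simp, intro]: "1 \<in> H"
    and mult_in [intro]: "a \<in> H \<Longrightarrow> b \<in> H \<Longrightarrow> a * b \<in> H"
begin

abbreviation L :: "'m fract set" where "L \<equiv> quot_group H"

lemma nonzero: "a \<in> H \<Longrightarrow> a \<noteq> 0"
  using zero_notin by blast

lemma power_in [intro]: "a \<in> H \<Longrightarrow> a ^ n \<in> H"
  by (induction n) auto

lemma prod_in: "(\<And>i. i \<in> A \<Longrightarrow> g i \<in> H) \<Longrightarrow> prod g A \<in> H"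
  by (induction A rule: infinite_finite_induct) auto

lemma quot_groupI [intro]: "a \<in> H \<Longrightarrow> b \<in> H \<Longrightarrow> to_fract a / to_fract b \<in> L"
  unfolding quot_group_def by blast

lemma quot_groupE:
  assumes "x \<in> L"
  obtains a b where "a \<in> H" "b \<in> H" "x = to_fract a / to_fract b"
  using assms unfolding quot_group_def by blast

lemma to_fract_in_quot_group [simp, intro]: "a \<in> H \<Longrightarrow> to_fract a \<in> L"
  using quot_groupI[of a 1] by simp

lemma quot_group_nonzero: "x \<in> L \<Longrightarrow> x \<noteq> 0"
  by (elim quot_groupE) (auto dest: nonzero)

lemma one_in_quot_group [simp]: "1 \<in> L"
  using to_fract_in_quot_group[of 1] by simp

lemma mult_in_quot_group [intro]:
  assumes "x \<in> L" "y \<in> L"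
  shows "x * y \<in> L"
proof -
  obtain a b c d where "a \<in> H" "b \<in> H" "c \<in> H" "d \<in> H"
    "x = to_fract a / to_fract b" "y = to_fract c / to_fract d"
    using assms by (elim quot_groupE) blast
  thus ?thesis using quot_groupI[of "a * c" "b * d"] by (auto simp: mult_in)
qed

lemma inverse_in_quot_group [intro]: "x \<in> L \<Longrightarrow> inverse x \<in> L"
  by (elim quot_groupE) (auto simp: quot_groupI)

lemma submon_simps [simp]:
  "carrier (submon H) = H" "a \<otimes>\<^bsub>submon H\<^esub> b = a * b" "\<one>\<^bsub>submon H\<^esub> = 1"
  by (simp_all add: submon_def)

end

section \<open>Extension of additive valuations to the quotient group\<close>

definition quot_val :: "'m::idom set \<Rightarrow> ('m \<Rightarrow> nat) \<Rightarrow> 'm fract \<Rightarrow> int" where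
  "quot_val H w x =
     (THE n. \<exists>a \<in> H. \<exists>b \<in> H. x = to_fract a / to_fract b \<and> n = int (w a) - int (w b))"

locale additive_valuation = domain_submonoid H for H :: "'m::idom set" +
  fixes w :: "'m \<Rightarrow> nat"
  assumes w_mult: "a \<in> H \<Longrightarrow> b \<in> H \<Longrightarrow> w (a * b) = w a + w b"
begin

lemma w_one [simp]: "w 1 = 0"
  using w_mult[of 1 1] by simp

lemma w_power: "a \<in> H \<Longrightarrow> w (a ^ n) = n * w a"
  by (induction n) (auto simp: w_mult power_in)

lemma w_prod: "(\<And>i. i \<in> A \<Longrightarrow> g i \<in> H) \<Longrightarrow> w (prod g A) = (\<Sum>i\<in>A. w (g i))"
  by (induction A rule: infinite_finite_induct) (auto simp: w_mult prod_in)

text \<open>Two representations of the same fraction satisfy \<open>a * d = c * b\<close>, so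
  additivity makes the difference of values independent of the choice; this justifies the definite
  description.\<close>

lemma quot_val_divide:
  assumes "a \<in> H" "b \<in> H"
  shows "quot_val H w (to_fract a / to_fract b) = int (w a) - int (w b)"
  unfolding quot_val_def
proof (rule the_equality)
  show "\<exists>a'\<in>H. \<exists>b'\<in>H. to_fract a / to_fract b = to_fract a' / to_fract b' \<and>
          int (w a) - int (w b) = int (w a') - int (w b')"
    using assms by blast
next
  fix n assume "\<exists>a'\<in>H. \<exists>b'\<in>H. to_fract a / to_fract b = to_fract a' / to_fract b' \<and>
          n = int (w a') - int (w b')"
  then obtain c d where cd: "c \<in> H" "d \<in> H" "to_fract a / to_fract b = to_fract c / to_fract d"
    "n = int (w c) - int (w d)" by blast
  have "to_fract (a * d) = to_fract (c * b)"
    using cd(3) assms(2) cd(2) by (simp add: frac_eq_eq nonzero)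
  hence "a * d = c * b" by (simp only: to_fract_eq_iff)
  hence "w (a * d) = w (c * b)" by simp
  thus "n = int (w a) - int (w b)" using assms cd by (simp add: w_mult)
qed

lemma quot_val_to_fract [simp]: "a \<in> H \<Longrightarrow> quot_val H w (to_fract a) = int (w a)"
  using quot_val_divide[of a 1] by simp

lemma quot_val_mult:
  assumes "x \<in> L" "y \<in> L"
  shows "quot_val H w (x * y) = quot_val H w x + quot_val H w y"
proof -
  obtain a b c d where *: "a \<in> H" "b \<in> H" "c \<in> H" "d \<in> H"
    "x = to_fract a / to_fract b" "y = to_fract c / to_fract d"
    using assms by (elim quot_groupE) blast
  have "x * y = to_fract (a * c) / to_fract (b * d)" using * by simp
  thus ?thesis using * by (simp add: quot_val_divide mult_in w_mult del: to_fract_mult)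
qed

lemma quot_val_inverse:
  assumes "x \<in> L"
  shows "quot_val H w (inverse x) = - quot_val H w x"
  using quot_val_mult[OF assms inverse_in_quot_group[OF assms]] quot_group_nonzero[OF assms]
    quot_val_to_fract[of 1] by simp

end

text \<open>
  The valuations \<open>v i\<close> are meant to be the facets of a cone: \<open>H\<close> is cut out of its quotient
  group by the conditions \<open>v i \<ge> 0\<close>, and each facet contains an element that lies on no other.
\<close>

locale facet_valuations = domain_submonoid H for H :: "'m::idom set" +
  fixes I :: "'i set" and v :: "'i \<Rightarrow> 'm \<Rightarrow> nat"
  assumes finite_I [simp, intro]: "finite I"
    and v_mult: "i \<in> I \<Longrightarrow> a \<in> H \<Longrightarrow> b \<in> H \<Longrightarrow> v i (a * b) = v i a + v i b"
    and v_dvd: "a \<in> H \<Longrightarrow> b \<in> H \<Longrightarrow> (\<And>i. i \<in> I \<Longrightarrow> v i a \<le> v i b) \<Longrightarrow> \<exists>c\<in>H. b = a * c"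
    and v_normalised: "i \<in> I \<Longrightarrow> \<exists>a\<in>H. v i a = 1"
    and v_facet: "i \<in> I \<Longrightarrow> \<exists>a\<in>H. v i a = 0 \<and> (\<forall>j\<in>I - {i}. v j a > 0)"
begin

abbreviation \<phi> :: "'i \<Rightarrow> 'm fract \<Rightarrow> int" where "\<phi> i \<equiv> quot_val H (v i)"

lemma additive_valuation: "i \<in> I \<Longrightarrow> additive_valuation H (v i)"
  by unfold_locales (auto simp: v_mult)

lemmas v_one = additive_valuation.w_one[OF additive_valuation]
lemmas v_power = additive_valuation.w_power[OF additive_valuation]
lemmas v_prod = additive_valuation.w_prod[OF additive_valuation]
lemmas \<phi>_divide = additive_valuation.quot_val_divide[OF additive_valuation]
lemmas \<phi>_to_fract [simp] = additive_valuation.quot_val_to_fract[OF additive_valuation]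
lemmas \<phi>_mult = additive_valuation.quot_val_mult[OF additive_valuation]
lemmas \<phi>_inverse = additive_valuation.quot_val_inverse[OF additive_valuation]

lemma \<phi>_one [simp]: "i \<in> I \<Longrightarrow> \<phi> i 1 = 0"
  using \<phi>_to_fract[of i 1] by (simp add: v_one)

text \<open>For a fraction of a by b, nonnegative values say that b is below a on every facet, and
  \<open>v_dvd\<close> then provides the quotient in H.\<close>

lemma mem_iff:
  assumes "x \<in> L"
  shows "x \<in> to_fract ` H \<longleftrightarrow> (\<forall>i\<in>I. \<phi> i x \<ge> 0)"
proof
  assume *: "\<forall>i\<in>I. \<phi> i x \<ge> 0"
  obtain a b where ab: "a \<in> H" "b \<in> H" "x = to_fract a / to_fract b"
    using assms by (elim quot_groupE)
  have "v i b \<le> v i a" if "i \<in> I" for i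
    using * that ab by (auto simp: \<phi>_divide)
  then obtain c where "c \<in> H" "a = b * c" using v_dvd ab by blast
  thus "x \<in> to_fract ` H" using ab nonzero by auto
qed auto

text \<open>A weak approximation: powers of an element of value 1 set the value at i, and a high
  power of an element lying only on facet i raises all other values without disturbing it.\<close>

lemma exists_prescribed_values:
  assumes "i \<in> I"
  shows "\<exists>x\<in>L. \<phi> i x = n \<and> (\<forall>j\<in>I - {i}. \<phi> j x \<ge> m)"
proof -
  obtain a where a: "a \<in> H" "v i a = 1" using v_normalised assms by blast
  obtain b where b: "b \<in> H" "v i b = 0" "\<And>j. j \<in> I - {i} \<Longrightarrow> v j b > 0"
    using v_facet[OF assms] by blast
  define s where "s = nat (- n)"
  \<comment> \<open>The first summand secures the bound m, the second outweighs the denominator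
    \<open>a ^ s\<close> on every other facet.\<close>
  define N where "N = nat m + s * (\<Sum>j\<in>I. v j a)"
  define x where "x = to_fract (a ^ nat n * b ^ N) / to_fract (a ^ s)"
  have x: "x \<in> L" unfolding x_def using a b by blast
  have \<phi>x: "\<phi> j x = int (nat n * v j a + N * v j b) - int (s * v j a)" if "j \<in> I" for j
    unfolding x_def using a b that
    by (subst \<phi>_divide) (auto simp: v_mult v_power mult_in power_in)
  have "\<phi> i x = n" using a b assms by (simp add: \<phi>x s_def)
  moreover have "\<phi> j x \<ge> m" if j: "j \<in> I - {i}" for j
  proof -
    have "v j a \<le> (\<Sum>j\<in>I. v j a)" using j by (intro member_le_sum) auto
    hence "nat m + s * v j a \<le> N" unfolding N_def by simp
    also have "N \<le> N * v j b" using b(3)[OF j] by simp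
    finally have "int (nat m + s * v j a) \<le> int (nat n * v j a + N * v j b)" by linarith
    moreover have "\<phi> j x = int (nat n * v j a + N * v j b) - int (s * v j a)" using \<phi>x j by blast
    moreover have "m \<le> int (nat m)" by simp
    ultimately show ?thesis unfolding of_nat_add[of "nat m"] by linarith
  qed
  ultimately show ?thesis using x by blast
qed

lemma exists_large: "\<exists>a\<in>H. \<forall>i\<in>I. int (v i a) \<ge> n"
proof (cases "I = {}")
  case False
  then obtain i where i: "i \<in> I" by blast
  obtain x where x: "x \<in> L" "\<phi> i x = max 0 n" "\<forall>j\<in>I - {i}. \<phi> j x \<ge> max 0 n"
    using exists_prescribed_values[OF i] by blast
  hence *: "\<phi> j x \<ge> max 0 n" if "j \<in> I" for j using that by (cases "j = i") auto
  hence "\<forall>j\<in>I. \<phi> j x \<ge> 0" by force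
  then obtain a where "a \<in> H" "x = to_fract a" using mem_iff[OF x(1)] by blast
  thus ?thesis using * by force
qed auto

lemma unit_iff: "u \<in> Units (submon H) \<longleftrightarrow> u \<in> H \<and> (\<forall>i\<in>I. v i u = 0)"
proof
  assume "u \<in> Units (submon H)"
  then obtain w where w: "u \<in> H" "w \<in> H" "w * u = 1" unfolding Units_def by auto
  thus "u \<in> H \<and> (\<forall>i\<in>I. v i u = 0)"
    using v_mult[of _ w u] v_one by auto
next
  assume u: "u \<in> H \<and> (\<forall>i\<in>I. v i u = 0)"
  then obtain w where "w \<in> H" "1 = u * w" using v_dvd[of u 1] v_one by auto
  thus "u \<in> Units (submon H)" using u unfolding Units_def by (auto simp: mult.commute)
qed

subsection \<open>Divisorial ideals\<close>

definition div_ideal :: "('i \<Rightarrow> int) \<Rightarrow> 'm fract set" where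
  "div_ideal a = {x \<in> L. \<forall>i\<in>I. \<phi> i x \<ge> a i}"

text \<open>Says that \<open>a i\<close> is the minimum of \<open>\<phi> i\<close> on Z for each i
  in I. The v-inverse and the v-closure of Z depend on these minima only.\<close>

definition attains :: "'m fract set \<Rightarrow> ('i \<Rightarrow> int) \<Rightarrow> bool" where
  "attains Z a \<longleftrightarrow> Z \<subseteq> div_ideal a \<and> (\<forall>i\<in>I. \<exists>y\<in>Z. \<phi> i y = a i)"

text \<open>Multiplying by z shifts every value by \<open>\<phi> i z\<close>, so z maps Z into H
  precisely when the shifted minima are nonnegative.\<close>

lemma v_inv_attains:
  assumes "attains Z a"
  shows "v_inv H Z = div_ideal (\<lambda>i. - a i)"
proof (intro Set.set_eqI iffI)
  fix z assume z: "z \<in> v_inv H Z"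
  hence zL: "z \<in> L" unfolding v_inv_def by blast
  have "\<phi> i z \<ge> - a i" if i: "i \<in> I" for i
  proof -
    obtain y where y: "y \<in> Z" "\<phi> i y = a i" using assms i unfolding attains_def by blast
    have yL: "y \<in> L" using y(1) assms unfolding attains_def div_ideal_def by blast
    have "z * y \<in> to_fract ` H" using z y unfolding v_inv_def elt_set_times_def by blast
    hence "\<phi> i (z * y) \<ge> 0" using mem_iff[of "z * y"] zL yL i by blast
    thus ?thesis using y zL yL i by (simp add: \<phi>_mult)
  qed
  thus "z \<in> div_ideal (\<lambda>i. - a i)" using zL unfolding div_ideal_def by blast
next
  fix z assume z: "z \<in> div_ideal (\<lambda>i. - a i)"
  have "z * y \<in> to_fract ` H" if y: "y \<in> Z" for y
  proof -
    have L: "z \<in> L" "y \<in> L" using z y assms unfolding attains_def div_ideal_def by blast+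
    have "\<phi> i (z * y) \<ge> 0" if "i \<in> I" for i
    proof -
      have "\<phi> i z \<ge> - a i" "\<phi> i y \<ge> a i"
        using z y assms that unfolding attains_def div_ideal_def by auto
      thus ?thesis using L that by (simp add: \<phi>_mult)
    qed
    thus ?thesis using mem_iff[of "z * y"] L by blast
  qed
  thus "z \<in> v_inv H Z" using z unfolding v_inv_def div_ideal_def elt_set_times_def by blast
qed

text \<open>The bounds are sharp: one value can be set to \<open>a i\<close> exactly while all
  others are kept above the maximum of a.\<close>

lemma attains_div_ideal: "attains (div_ideal a) a"
proof -
  have "\<exists>y\<in>div_ideal a. \<phi> i y = a i" if i: "i \<in> I" for i
  proof -
    obtain y where y: "y \<in> L" "\<phi> i y = a i" "\<forall>j\<in>I - {i}. \<phi> j y \<ge> (Max (a ` I))"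
      using exists_prescribed_values[OF i] by blast
    have "\<phi> j y \<ge> a j" if "j \<in> I" for j
    proof (cases "j = i")
      case False
      have "a j \<le> Max (a ` I)" using that by simp
      also have "\<dots> \<le> \<phi> j y" using y(3) False that by blast
      finally show ?thesis .
    qed (use y in simp)
    thus ?thesis using y unfolding div_ideal_def by blast
  qed
  thus ?thesis unfolding attains_def by blast
qed

lemma v_closure_attains: "attains Z a \<Longrightarrow> v_closure H Z = div_ideal a"
  unfolding v_closure_def using v_inv_attains[of Z a] v_inv_attains[OF attains_div_ideal] by simp

lemma attains_unique: "attains Z a \<Longrightarrow> attains Z b \<Longrightarrow> i \<in> I \<Longrightarrow> a i = b i"
  unfolding attains_def div_ideal_def by (smt (verit) mem_Collect_eq subsetD)

lemma div_ideal_eqD: "div_ideal a = div_ideal b \<Longrightarrow> i \<in> I \<Longrightarrow> a i = b i"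
  using attains_unique[of "div_ideal a" a b i] attains_div_ideal by metis

lemma div_ideal_cong: "(\<And>i. i \<in> I \<Longrightarrow> a i = b i) \<Longrightarrow> div_ideal a = div_ideal b"
  unfolding div_ideal_def by auto

text \<open>Minima add, because for each i the minimizers in the two factors can be chosen
  independently.\<close>

lemma attains_times:
  assumes "attains Y a" "attains Z b"
  shows "attains (Y * Z) (\<lambda>i. a i + b i)"
  unfolding attains_def
proof (intro conjI ballI subsetI)
  fix x assume "x \<in> Y * Z"
  then obtain y z where yz: "y \<in> Y" "z \<in> Z" "x = y * z" by (elim set_times_elim)
  hence L: "y \<in> L" "z \<in> L" using assms unfolding attains_def div_ideal_def by blast+
  have "\<phi> i x \<ge> a i + b i" if "i \<in> I" for i
  proof -
    have "\<phi> i y \<ge> a i" "\<phi> i z \<ge> b i"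
      using assms yz that unfolding attains_def div_ideal_def by auto
    thus ?thesis using yz L that by (simp add: \<phi>_mult)
  qed
  thus "x \<in> div_ideal (\<lambda>i. a i + b i)" using yz L unfolding div_ideal_def by blast
next
  fix i assume i: "i \<in> I"
  then obtain y z where yz: "y \<in> Y" "z \<in> Z" "\<phi> i y = a i" "\<phi> i z = b i"
    using assms unfolding attains_def by meson
  hence L: "y \<in> L" "z \<in> L" using assms unfolding attains_def div_ideal_def by blast+
  show "\<exists>x\<in>Y * Z. \<phi> i x = a i + b i"
    using yz L i by (intro bexI[of _ "y * z"]) (auto simp: \<phi>_mult)
qed

lemma v_closure_div_ideal_times:
  "v_closure H (div_ideal a * div_ideal b) = div_ideal (\<lambda>i. a i + b i)"
  by (intro v_closure_attains attains_times attains_div_ideal)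

lemma principal_eq_div_ideal:
  assumes "x \<in> L"
  shows "x *o (to_fract ` H) = div_ideal (\<lambda>i. \<phi> i x)"
proof (intro Set.set_eqI iffI)
  fix y assume "y \<in> x *o (to_fract ` H)"
  then obtain a where "a \<in> H" "y = x * to_fract a" unfolding elt_set_times_def by blast
  thus "y \<in> div_ideal (\<lambda>i. \<phi> i x)" using assms unfolding div_ideal_def by (auto simp: \<phi>_mult)
next
  fix y assume y: "y \<in> div_ideal (\<lambda>i. \<phi> i x)"
  define z where "z = y * inverse x"
  have yL: "y \<in> L" and y_ge: "\<And>i. i \<in> I \<Longrightarrow> \<phi> i y \<ge> \<phi> i x" using y unfolding div_ideal_def by auto
  have zL: "z \<in> L" unfolding z_def using assms yL by blast
  have "\<phi> i z \<ge> 0" if "i \<in> I" for i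
    using y_ge[OF that] that assms yL unfolding z_def by (simp add: \<phi>_mult \<phi>_inverse inverse_in_quot_group)
  hence "z \<in> to_fract ` H" using mem_iff zL by blast
  moreover have "y = x * z" unfolding z_def using quot_group_nonzero[OF assms] by simp
  ultimately show "y \<in> x *o (to_fract ` H)" unfolding elt_set_times_def by blast
qed

lemma to_fract_image_eq_div_ideal: "to_fract ` H = div_ideal (\<lambda>_. 0)"
proof -
  have "to_fract ` H = 1 *o (to_fract ` H)" by (simp add: elt_set_times_def)
  also have "\<dots> = div_ideal (\<lambda>_. 0)"
    by (subst principal_eq_div_ideal) (auto intro!: div_ideal_cong)
  finally show ?thesis .
qed

text \<open>A single element b of H with values at least the absolute values of a serves twice: it
  lies in the ideal, and it is a common denominator.\<close>

lemma div_ideal_in_frac_v_ideals: "div_ideal a \<in> frac_v_ideals H"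
proof -
  obtain b where b: "b \<in> H" "\<forall>i\<in>I. int (v i b) \<ge> Max (insert 0 ((\<lambda>i. \<bar>a i\<bar>) ` I))"
    using exists_large by blast
  have abs: "\<bar>a i\<bar> \<le> int (v i b)" if "i \<in> I" for i
  proof -
    have "\<bar>a i\<bar> \<le> Max (insert 0 ((\<lambda>i. \<bar>a i\<bar>) ` I))" using that by (intro Max_ge) auto
    thus ?thesis using b that by force
  qed
  have "to_fract b \<in> div_ideal a" using b(1) abs unfolding div_ideal_def by force
  moreover have "to_fract b * y \<in> to_fract ` H" if "y \<in> div_ideal a" for y
  proof -
    have "\<phi> i (to_fract b * y) \<ge> 0" if "i \<in> I" for i
      using \<open>y \<in> div_ideal a\<close> abs[OF that] b(1) that unfolding div_ideal_def by (force simp: \<phi>_mult)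
    thus ?thesis using mem_iff[of "to_fract b * y"] that b(1) unfolding div_ideal_def by blast
  qed
  ultimately show ?thesis
    using v_closure_attains[OF attains_div_ideal, of a] b(1)
    unfolding frac_v_ideals_def elt_set_times_def div_ideal_def by blast
qed

text \<open>A common denominator bounds the values on J from below, so integer minima exist; J,
  being v-closed, is the ideal determined by them.\<close>

lemma frac_v_ideals_eq: "frac_v_ideals H = range div_ideal"
proof (intro Set.set_eqI iffI)
  fix J assume "J \<in> frac_v_ideals H"
  then obtain b where J: "J \<subseteq> L" "J \<noteq> {}" "b \<in> H" "to_fract b *o J \<subseteq> to_fract ` H" "v_closure H J = J"
    unfolding frac_v_ideals_def by blast
  have bound: "\<phi> i y \<ge> - int (v i b)" if "i \<in> I" "y \<in> J" for i y
  proof -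
    have "to_fract b * y \<in> to_fract ` H" using J(4) that unfolding elt_set_times_def by blast
    hence "\<phi> i (to_fract b * y) \<ge> 0" using mem_iff[of "to_fract b * y"] J that by blast
    thus ?thesis using J that by (auto simp: \<phi>_mult)
  qed
  have "\<exists>n. (\<forall>y\<in>J. \<phi> i y \<ge> n) \<and> (\<exists>y\<in>J. \<phi> i y = n)" if i: "i \<in> I" for i
  proof -
    \<comment> \<open>Shifting by the value of the denominator makes all values natural numbers, so
      that a least one exists.\<close>
    define S where "S = (\<lambda>y. nat (\<phi> i y + int (v i b))) ` J"
    have "S \<noteq> {}" using J unfolding S_def by blast
    hence "(LEAST s. s \<in> S) \<in> S" by (meson LeastI ex_in_conv)
    then obtain y where y: "y \<in> J" "nat (\<phi> i y + int (v i b)) = (LEAST s. s \<in> S)"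
      unfolding S_def by auto
    have "\<phi> i y \<le> \<phi> i z" if "z \<in> J" for z
    proof -
      have "nat (\<phi> i y + int (v i b)) \<le> nat (\<phi> i z + int (v i b))"
        unfolding y(2) by (rule Least_le) (use that in \<open>auto simp: S_def\<close>)
      thus ?thesis using bound[OF i y(1)] bound[OF i that] by linarith
    qed
    thus ?thesis using y by blast
  qed
  then obtain a where "\<forall>i\<in>I. (\<forall>y\<in>J. \<phi> i y \<ge> a i) \<and> (\<exists>y\<in>J. \<phi> i y = a i)" by metis
  hence "attains J a" using J(1) unfolding attains_def div_ideal_def by blast
  thus "J \<in> range div_ideal" using v_closure_attains J(5) by blast
qed (auto simp: div_ideal_in_frac_v_ideals)

abbreviation Z\<^sub>I :: "('i \<Rightarrow> int) monoid" where
  "Z\<^sub>I \<equiv> product_group I (\<lambda>_. integer_group)"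

lemma group_Z\<^sub>I: "group Z\<^sub>I"
  by (simp add: group_integer_group)

lemma div_ideal_iso: "div_ideal \<in> iso Z\<^sub>I (v_ideal_group H)"
proof -
  have "div_ideal \<in> hom Z\<^sub>I (v_ideal_group H)"
    by (auto simp: hom_def v_ideal_group_def div_ideal_in_frac_v_ideals v_closure_div_ideal_times
        product_group_def integer_group_def intro!: div_ideal_cong)
  moreover have "inj_on div_ideal (carrier Z\<^sub>I)"
  proof (rule inj_onI)
    fix a b assume ab: "a \<in> carrier Z\<^sub>I" "b \<in> carrier Z\<^sub>I" "div_ideal a = div_ideal b"
    show "a = b"
    proof (rule PiE_ext)
      show "a \<in> (\<Pi>\<^sub>E i\<in>I. UNIV)" "b \<in> (\<Pi>\<^sub>E i\<in>I. UNIV)"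
        using ab by (auto simp: product_group_def integer_group_def)
    qed (use div_ideal_eqD ab in blast)
  qed
  moreover have "div_ideal ` carrier Z\<^sub>I = frac_v_ideals H"
  proof -
    \<comment> \<open>Elements of the carrier are \<open>undefined\<close> outside I, while
      \<open>div_ideal\<close> ignores the values there.\<close>
    have "div_ideal a \<in> div_ideal ` carrier Z\<^sub>I" for a
      by (rule image_eqI[of _ _ "restrict a I"])
         (auto intro!: div_ideal_cong simp: product_group_def integer_group_def)
    thus ?thesis using frac_v_ideals_eq div_ideal_in_frac_v_ideals by auto
  qed
  ultimately show ?thesis unfolding iso_def bij_betw_def by (simp add: v_ideal_group_def)
qed

text \<open>The group laws are transported from \<open>Z\<^sub>I\<close> along
  \<open>div_ideal\<close>, which replaces a direct check of associativity and inverses for the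
  v-product.\<close>

lemma group_v_ideal_group: "group (v_ideal_group H)"
proof -
  interpret group Z\<^sub>I by (rule group_Z\<^sub>I)
  have "div_ideal \<in> hom Z\<^sub>I (v_ideal_group H)" "div_ideal ` carrier Z\<^sub>I = frac_v_ideals H"
    using div_ideal_iso unfolding iso_def bij_betw_def by (auto simp: v_ideal_group_def)
  moreover have "div_ideal \<one>\<^bsub>Z\<^sub>I\<^esub> = to_fract ` H"
    unfolding to_fract_image_eq_div_ideal by (rule div_ideal_cong) (simp add: product_group_def integer_group_def)
  ultimately show ?thesis using hom_imp_img_group[of div_ideal "v_ideal_group H"]
    by (simp add: v_ideal_group_def)
qed

text \<open>The first isomorphism theorem for \<open>\<psi>\<close> composed with the inverse of
  \<open>div_ideal\<close>: the vectors of principal ideals are those of the form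
  \<open>\<phi> i x\<close>, so \<open>ker\<close> says that the kernel consists of the principal
  ideals.\<close>

lemma class_group_iso:
  assumes "group G" and \<psi>: "\<psi> \<in> hom Z\<^sub>I G" "\<psi> ` carrier Z\<^sub>I = carrier G"
    and ker: "\<And>a. a \<in> carrier Z\<^sub>I \<Longrightarrow> \<psi> a = \<one>\<^bsub>G\<^esub> \<longleftrightarrow> (\<exists>x\<in>L. \<forall>i\<in>I. a i = \<phi> i x)"
  shows "class_group H \<cong> G"
proof -
  define h where "h = \<psi> \<circ> inv_into (carrier Z\<^sub>I) div_ideal"
  interpret Z: group Z\<^sub>I by (rule group_Z\<^sub>I)
  interpret V: group "v_ideal_group H" by (rule group_v_ideal_group)
  have inv: "inv_into (carrier Z\<^sub>I) div_ideal \<in> iso (v_ideal_group H) Z\<^sub>I"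
    by (rule Z.iso_set_sym[OF div_ideal_iso])
  have "h \<in> hom (v_ideal_group H) G" unfolding h_def
    by (rule hom_compose[OF _ \<psi>(1)]) (use inv in \<open>simp add: iso_def\<close>)
  then interpret group_hom "v_ideal_group H" G h
    using assms(1) by (simp add: group_hom_def group_hom_axioms_def V.group_axioms)
  have onto: "h ` carrier (v_ideal_group H) = carrier G"
    using inv \<psi>(2) unfolding h_def image_comp[symmetric] iso_def bij_betw_def by simp
  have h_div: "h (div_ideal a) = \<psi> a" if "a \<in> carrier Z\<^sub>I" for a
    using that div_ideal_iso unfolding h_def iso_def bij_betw_def by simp
  have "kernel (v_ideal_group H) G h = principal_frac_ideals H"
  proof (intro Set.set_eqI iffI)
    fix J assume J: "J \<in> kernel (v_ideal_group H) G h"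
    then obtain a where a: "a \<in> carrier Z\<^sub>I" "J = div_ideal a"
      using div_ideal_iso unfolding kernel_def iso_def bij_betw_def by (auto simp del: carrier_product_group)
    then obtain x where x: "x \<in> L" "\<forall>i\<in>I. a i = \<phi> i x"
      using J ker h_div unfolding kernel_def by auto
    have "J = x *o (to_fract ` H)"
      unfolding a(2) principal_eq_div_ideal[OF x(1)] by (rule div_ideal_cong) (use x in simp)
    thus "J \<in> principal_frac_ideals H"
      unfolding principal_frac_ideals_def using x(1) by blast
  next
    fix J assume "J \<in> principal_frac_ideals H"
    then obtain x where x: "x \<in> L" "J = x *o (to_fract ` H)" unfolding principal_frac_ideals_def by blast
    define a where "a = restrict (\<lambda>i. \<phi> i x) I"
    have a: "a \<in> carrier Z\<^sub>I" by (simp add: a_def product_group_def integer_group_def)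
    have J: "J = div_ideal a"
      using x principal_eq_div_ideal by (auto simp: a_def intro!: div_ideal_cong)
    have "\<psi> a = \<one>\<^bsub>G\<^esub>" using ker[OF a] x by (auto simp: a_def)
    thus "J \<in> kernel (v_ideal_group H) G h"
      using h_div[OF a] J div_ideal_in_frac_v_ideals by (simp add: kernel_def v_ideal_group_def)
  qed
  thus ?thesis using FactGroup_iso[OF onto] unfolding class_group_def by simp
qed

subsection \<open>Height-one primes\<close>

definition prime_of :: "'i \<Rightarrow> 'm set" where
  "prime_of i = {x \<in> H. v i x > 0}"

lemma prime_s_ideal_prime_of:
  assumes "i \<in> I"
  shows "prime_s_ideal H (prime_of i)"
proof -
  have "prime_of i * H = prime_of i"
  proof (intro Set.set_eqI iffI)
    fix x assume "x \<in> prime_of i"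
    thus "x \<in> prime_of i * H" using set_times_intro[of x "prime_of i" 1 H] by simp
  qed (use assms in \<open>auto simp: prime_of_def v_mult elim!: set_times_elim\<close>)
  moreover have "prime_of i \<subseteq> H" by (auto simp: prime_of_def)
  moreover have 1: "1 \<in> H - prime_of i" using assms by (simp add: prime_of_def v_one)
  moreover have "prime_of i \<noteq> H" using 1 one_in by blast
  moreover have "x * y \<in> H - prime_of i" if "x \<in> H - prime_of i" "y \<in> H - prime_of i" for x y
    using that assms by (auto simp: prime_of_def v_mult)
  ultimately show ?thesis
    unfolding prime_s_ideal_def s_ideal_def submonoid_def submon_simps by blast
qed

lemma prime_s_idealD:
  assumes "prime_s_ideal H P"
  shows "P \<subseteq> H" "1 \<notin> P" "a \<in> P \<Longrightarrow> b \<in> H \<Longrightarrow> a * b \<in> P"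
    "a \<in> H \<Longrightarrow> b \<in> H \<Longrightarrow> a * b \<in> P \<Longrightarrow> a \<in> P \<or> b \<in> P"
  using assms set_times_intro[of a P b H]
  unfolding prime_s_ideal_def s_ideal_def submonoid_def by auto

lemma prime_s_ideal_prod:
  assumes "prime_s_ideal H P" "\<And>i. i \<in> A \<Longrightarrow> g i \<in> H" "prod g A \<in> P"
  shows "\<exists>i\<in>A. g i \<in> P"
  using assms(2,3)
proof (induction A rule: infinite_finite_induct)
  case (insert x A)
  thus ?case using prime_s_idealD(4)[OF assms(1), of "g x" "prod g A"] prod_in[of A g] by auto
qed (use prime_s_idealD[OF assms(1)] in auto)

text \<open>Otherwise choose in each \<open>prime_of i\<close> an element outside P. Their product
  is positive on all facets, so a power of it is divisible by a given element of P and lies in P;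
  primality then puts one of the chosen elements into P.\<close>

lemma prime_s_ideal_contains_prime_of:
  assumes P: "prime_s_ideal H P" "P \<noteq> {}"
  shows "\<exists>i\<in>I. prime_of i \<subseteq> P"
proof (rule ccontr)
  assume "\<not> ?thesis"
  hence "\<forall>i\<in>I. \<exists>y. y \<in> prime_of i \<and> y \<notin> P" by blast
  then obtain y where "\<forall>i\<in>I. y i \<in> prime_of i \<and> y i \<notin> P" by metis
  hence y: "y i \<in> prime_of i" "y i \<notin> P" if "i \<in> I" for i using that by blast+
  obtain x where x: "x \<in> P" using P by blast
  have xH: "x \<in> H" using x prime_s_idealD(1)[OF P(1)] by blast
  have yH: "y i \<in> H" if "i \<in> I" for i using y(1)[OF that] by (simp add: prime_of_def)
  define N where "N = (\<Sum>i\<in>I. v i x)"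
  define z where "z = prod y I"
  have zH: "z \<in> H" unfolding z_def using yH by (intro prod_in)
  have "v i x \<le> v i (z ^ N)" if i: "i \<in> I" for i
  proof -
    have "v i x \<le> N" unfolding N_def using i by (intro member_le_sum) auto
    moreover have "v i (y i) \<le> v i z"
      unfolding z_def using i yH by (subst v_prod) (auto intro!: member_le_sum)
    moreover have "v i (y i) > 0" using y(1)[OF i] by (simp add: prime_of_def)
    ultimately have "v i x \<le> N * v i z" using mult_le_mono[of "v i x" N 1 "v i z"] by simp
    thus ?thesis using i zH by (simp add: v_power)
  qed
  then obtain c where "c \<in> H" "z ^ N = x * c" using v_dvd[OF xH power_in[OF zH]] by blast
  hence "z ^ N \<in> P" using prime_s_idealD(3)[OF P(1) x] by simp
  \<comment> \<open>Written as a product over an index set, the power falls under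
    \<open>prime_s_ideal_prod\<close>, including the exponent 0.\<close>
  hence "(\<Prod>_\<in>{..<N}. z) \<in> P" by simp
  hence "z \<in> P" using prime_s_ideal_prod[OF P(1), of "{..<N}" "\<lambda>_. z"] zH by blast
  thus False using prime_s_ideal_prod[OF P(1), of I y] yH y(2) unfolding z_def by blast
qed

lemma prime_of_nonempty: "i \<in> I \<Longrightarrow> prime_of i \<noteq> {}"
  using v_normalised[of i] unfolding prime_of_def by force

text \<open>The element lying only on facet j belongs to \<open>prime_of i\<close> for every other
  i, but not to \<open>prime_of j\<close>.\<close>

lemma prime_of_subsetD:
  assumes "i \<in> I" "j \<in> I" "prime_of i \<subseteq> prime_of j"
  shows "i = j"
proof (rule ccontr)
  assume "i \<noteq> j"
  moreover obtain a where "a \<in> H" "v j a = 0" "\<forall>k\<in>I - {j}. v k a > 0" using v_facet[OF assms(2)] by blast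
  ultimately have "a \<in> prime_of i - prime_of j" using assms(1) unfolding prime_of_def by auto
  thus False using assms(3) by blast
qed

lemma inj_prime_of: "inj_on prime_of I"
  using prime_of_subsetD by (auto intro!: inj_onI)

lemma height_one_primes_eq: "height_one_primes H = prime_of ` I"
proof (intro Set.set_eqI iffI)
  fix P assume "P \<in> height_one_primes H"
  hence P: "prime_s_ideal H P" "P \<noteq> {}" "\<forall>P'. prime_s_ideal H P' \<and> P' \<noteq> {} \<and> P' \<subseteq> P \<longrightarrow> P' = P"
    unfolding height_one_primes_def by simp_all
  obtain i where i: "i \<in> I" "prime_of i \<subseteq> P" using prime_s_ideal_contains_prime_of[OF P(1,2)] by blast
  hence "prime_of i = P" using P(3) prime_s_ideal_prime_of prime_of_nonempty by simp
  thus "P \<in> prime_of ` I" using i by blast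
next
  fix P assume "P \<in> prime_of ` I"
  then obtain i where i: "i \<in> I" "P = prime_of i" by blast
  have "P' = P" if P': "prime_s_ideal H P'" "P' \<noteq> {}" "P' \<subseteq> P" for P'
  proof -
    obtain j where "j \<in> I" "prime_of j \<subseteq> P'" using prime_s_ideal_contains_prime_of P' by blast
    moreover from this have "j = i" using P'(3) i prime_of_subsetD by blast
    ultimately show ?thesis using i P' by blast
  qed
  thus "P \<in> height_one_primes H"
    using i prime_s_ideal_prime_of[OF i(1)] prime_of_nonempty[OF i(1)]
    unfolding height_one_primes_def by simp
qed

abbreviation unit_vec :: "'i \<Rightarrow> 'i \<Rightarrow> int" where
  "unit_vec i j \<equiv> (if j = i then 1 else 0)"

lemma to_fract_prime_of:
  assumes "i \<in> I"
  shows "to_fract ` prime_of i = div_ideal (unit_vec i)"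
proof (intro Set.set_eqI iffI)
  fix x assume x: "x \<in> div_ideal (unit_vec i)"
  hence xL: "x \<in> L" and *: "\<And>j. j \<in> I \<Longrightarrow> \<phi> j x \<ge> unit_vec i j" unfolding div_ideal_def by auto
  have "\<phi> j x \<ge> 0" if "j \<in> I" for j using *[OF that] by (simp split: if_splits)
  then obtain a where a: "a \<in> H" "x = to_fract a" using mem_iff[OF xL] by blast
  thus "x \<in> to_fract ` prime_of i" using *[OF assms] assms by (auto simp: prime_of_def)
qed (use assms in \<open>auto simp: prime_of_def div_ideal_def\<close>)

lemma principal_prime_of_iff:
  assumes "i \<in> I"
  shows "principal_ideal H (prime_of i) \<longleftrightarrow> (\<exists>x\<in>H. \<forall>j\<in>I. int (v j x) = unit_vec i j)"
proof -
  have "prime_of i = x *o H \<longleftrightarrow> (\<forall>j\<in>I. int (v j x) = unit_vec i j)" if x: "x \<in> H" for x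
  proof -
    have "prime_of i = x *o H \<longleftrightarrow> to_fract ` prime_of i = to_fract ` (x *o H)"
      by (simp add: inj_image_eq_iff inj_def)
    also have "to_fract ` (x *o H) = to_fract x *o (to_fract ` H)"
      by (force simp: elt_set_times_def)
    also have "\<dots> = div_ideal (\<lambda>j. \<phi> j (to_fract x))" using x by (simp add: principal_eq_div_ideal)
    also have "\<dots> = div_ideal (\<lambda>j. int (v j x))" using x by (intro div_ideal_cong) simp
    also have "to_fract ` prime_of i = \<dots> \<longleftrightarrow> (\<forall>j\<in>I. int (v j x) = unit_vec i j)"
      unfolding to_fract_prime_of[OF assms] by (auto dest: div_ideal_eqD intro!: div_ideal_cong)
    finally show ?thesis .
  qed
  thus ?thesis unfolding principal_ideal_def by blast
qed

text \<open>The coset of the first ideal contains that ideal itself (take x = 1), hence it is a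
  principal translate of the second; comparing vectors gives x.\<close>

lemma ideal_class_eqD:
  assumes "i \<in> I" "j \<in> I" "ideal_class H (prime_of i) = ideal_class H (prime_of j)"
  shows "\<exists>x\<in>L. \<forall>k\<in>I. unit_vec i k = \<phi> k x + unit_vec j k"
proof -
  have coset: "ideal_class H (prime_of l) =
      (\<lambda>x. div_ideal (\<lambda>k. \<phi> k x + unit_vec l k)) ` L" if "l \<in> I" for l
    unfolding ideal_class_def r_coset_def principal_frac_ideals_def v_ideal_group_def
      to_fract_prime_of[OF that]
    by (auto simp: principal_eq_div_ideal v_closure_div_ideal_times)
  have "div_ideal (unit_vec i) = div_ideal (\<lambda>k. \<phi> k 1 + unit_vec i k)"
    by (rule div_ideal_cong) simp
  hence "div_ideal (unit_vec i) \<in> ideal_class H (prime_of i)"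
    unfolding coset[OF assms(1)] by (rule image_eqI) simp
  hence "div_ideal (unit_vec i) \<in> (\<lambda>x. div_ideal (\<lambda>k. \<phi> k x + unit_vec j k)) ` L"
    unfolding assms(3) coset[OF assms(2)] .
  then obtain x where x: "x \<in> L" "div_ideal (unit_vec i) = div_ideal (\<lambda>k. \<phi> k x + unit_vec j k)"
    by (elim imageE)
  from div_ideal_eqD[OF x(2)] x(1) show ?thesis by (intro bexI[of _ x]) simp_all
qed

subsection \<open>Factoriality\<close>

text \<open>Divisibility by p amounts to a positive value at i, and a sum of naturals is positive
  only if a summand is.\<close>

lemma prime_if_unit_vec:
  assumes i: "i \<in> I" and p: "p \<in> H" "\<And>j. j \<in> I \<Longrightarrow> int (v j p) = unit_vec i j"
  shows "Divisibility.prime (submon H) p"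
proof -
  have dvd_iff: "p divides\<^bsub>submon H\<^esub> a \<longleftrightarrow> v i a > 0" if a: "a \<in> H" for a
  proof
    assume "p divides\<^bsub>submon H\<^esub> a"
    then obtain c where "c \<in> H" "a = p * c" unfolding factor_def by auto
    thus "v i a > 0" using p(1) p(2)[OF i] i by (simp add: v_mult)
  next
    assume *: "v i a > 0"
    have "v j p \<le> v j a" if "j \<in> I" for j using p(2)[OF that] * by (auto split: if_splits)
    thus "p divides\<^bsub>submon H\<^esub> a" using v_dvd[OF p(1) a] unfolding factor_def by auto
  qed
  show ?thesis unfolding Divisibility.prime_def
    using p(2)[OF i] i by (auto simp: unit_iff dvd_iff mult_in v_mult intro!: bexI[of _ i])
qed

lemma factorial_if_unit_vecs:
  assumes "\<And>i. i \<in> I \<Longrightarrow> \<exists>p\<in>H. \<forall>j\<in>I. int (v j p) = unit_vec i j"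
  shows "factorial H"
proof -
  let ?P = "\<lambda>p. p \<in> H \<and> (\<exists>i\<in>I. \<forall>j\<in>I. int (v j p) = unit_vec i j)"
  have "\<exists>ps. (\<forall>p\<in>set ps. ?P p) \<and> a = prod_list ps"
    if "a \<in> H" "a \<notin> Units (submon H)" for a
    using that
  proof (induction "\<Sum>i\<in>I. v i a" arbitrary: a rule: less_induct)
    case less
    then obtain i where i: "i \<in> I" "v i a > 0" unfolding unit_iff by auto
    obtain p where p: "p \<in> H" "\<And>j. j \<in> I \<Longrightarrow> int (v j p) = unit_vec i j" using assms[OF i(1)] by blast
    have "v j p \<le> v j a" if "j \<in> I" for j using p(2)[OF that] i by (auto split: if_splits)
    then obtain c where c: "c \<in> H" "a = p * c" using v_dvd[OF p(1) less(2)] by blast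
    have va: "int (v j a) = unit_vec i j + int (v j c)" if "j \<in> I" for j
      using c p that by (simp add: v_mult)
    show ?case
    proof (cases "c \<in> Units (submon H)")
      case True
      \<comment> \<open>The unit cofactor is absorbed: \<open>a\<close> itself has the value vector
        of a prime.\<close>
      hence "\<forall>j\<in>I. int (v j a) = unit_vec i j" using va unfolding unit_iff by auto
      hence "?P a" using i less by blast
      thus ?thesis by (intro exI[of _ "[a]"]) auto
    next
      case False
      have le: "\<And>j. j \<in> I \<Longrightarrow> v j c \<le> v j a" using va by (smt (verit) of_nat_le_iff)
      have "v i c < v i a" using va[OF i(1)] by simp
      hence "(\<Sum>j\<in>I. v j c) < (\<Sum>j\<in>I. v j a)" by (intro sum_strict_mono_ex1) (use le i in auto)
      then obtain ps where "\<forall>p\<in>set ps. ?P p" "c = prod_list ps" using less(1)[OF _ c(1) False] by blast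
      thus ?thesis using p i c by (intro exI[of _ "p # ps"]) auto
    qed
  qed
  thus ?thesis unfolding factorial_def using prime_if_unit_vec by (metis DiffE subsetI)
qed

text \<open>An element of value 1 at i has a prime factor p of positive value at i. Then
  \<open>p *o H\<close> is a prime s-ideal inside \<open>prime_of i\<close>, and minimality of the
  latter forces equality.\<close>

lemma unit_vecs_if_factorial:
  assumes "factorial H" "i \<in> I"
  shows "\<exists>p\<in>H. \<forall>j\<in>I. int (v j p) = unit_vec i j"
proof -
  obtain y where y: "y \<in> H" "v i y = 1" using v_normalised assms by blast
  have "y \<notin> Units (submon H)" using y assms(2) unfolding unit_iff by force
  then obtain ps where ps: "set ps \<subseteq> H" "\<forall>p\<in>set ps. Divisibility.prime (submon H) p" "y = prod_list ps"
    using assms(1) y(1) unfolding factorial_def by blast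
  have "v i (prod_list qs) = 0" if "set qs \<subseteq> H" "\<forall>p\<in>set qs. v i p = 0" for qs
  proof -
    have "prod_list qs \<in> H \<and> v i (prod_list qs) = 0"
      using that by (induction qs) (auto simp: v_one[OF assms(2)] v_mult[OF assms(2)])
    thus ?thesis ..
  qed
  then obtain p where p: "p \<in> H" "Divisibility.prime (submon H) p" "v i p > 0"
    using ps y by (metis gr0I subsetD zero_neq_one)
  have *: "x \<in> p *o H \<longleftrightarrow> x \<in> H \<and> p divides\<^bsub>submon H\<^esub> x" for x
    using p(1) unfolding elt_set_times_def factor_def by auto
  have "prime_s_ideal H (p *o H)"
  proof -
    have "(p *o H) * H = p *o H"
    proof (intro Set.set_eqI iffI)
      fix x assume "x \<in> p *o H"
      thus "x \<in> (p *o H) * H" using set_times_intro[of x "p *o H" 1 H] by simp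
    next
      fix x assume "x \<in> (p *o H) * H"
      then obtain a b where "a \<in> H" "b \<in> H" "x = p * a * b"
        unfolding elt_set_times_def set_times_def by auto
      thus "x \<in> p *o H" unfolding elt_set_times_def by (auto simp: mult.assoc)
    qed
    moreover have "1 \<notin> p *o H"
    proof
      assume "1 \<in> p *o H"
      hence "p \<in> Units (submon H)" unfolding elt_set_times_def Units_def
        using p(1) by (auto simp: mult.commute)
      thus False using p(2) unfolding Divisibility.prime_def by blast
    qed
    moreover have "x * y \<in> H - p *o H" if "x \<in> H - p *o H" "y \<in> H - p *o H" for x y
    proof -
      have "x \<in> H" "y \<in> H" "\<not> p divides\<^bsub>submon H\<^esub> x" "\<not> p divides\<^bsub>submon H\<^esub> y"
        using that * by auto
      moreover from this have "\<not> p divides\<^bsub>submon H\<^esub> (x * y)"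
        using p(2) unfolding Divisibility.prime_def submon_simps by blast
      ultimately show ?thesis by (simp add: * mult_in)
    qed
    ultimately show ?thesis unfolding prime_s_ideal_def s_ideal_def submonoid_def
      by (auto simp: * )
  qed
  moreover have "p *o H \<noteq> {}" unfolding elt_set_times_def by blast
  moreover have "p *o H \<subseteq> prime_of i"
    using p assms(2) unfolding elt_set_times_def prime_of_def by (auto simp: v_mult)
  moreover have "prime_of i \<in> height_one_primes H" using height_one_primes_eq assms(2) by blast
  ultimately have "p *o H = prime_of i" unfolding height_one_primes_def by simp
  hence "principal_ideal H (prime_of i)" unfolding principal_ideal_def using p(1) by blast
  thus ?thesis unfolding principal_prime_of_iff[OF assms(2)] .
qed

lemma factorial_iff: "factorial H \<longleftrightarrow> (\<forall>i\<in>I. \<exists>p\<in>H. \<forall>j\<in>I. int (v j p) = unit_vec i j)"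
  using factorial_if_unit_vecs unit_vecs_if_factorial by blast

end

section \<open>Polynomials over a factorial domain\<close>

subsection \<open>Essential subsets of a family of linear forms\<close>

text \<open>Induction on the coordinates. With N bounding the new coordinate on a finite set that
  works for the old ones, points whose new coordinate is at least N are dominated by that set; each
  of the finitely many smaller values n gets its own finite set \<open>D n\<close>.\<close>

lemma dickson:
  fixes w :: "'c \<Rightarrow> 'b \<Rightarrow> nat"
  assumes "finite B"
  shows "\<exists>C0\<subseteq>C. finite C0 \<and> (\<forall>c\<in>C. \<exists>c0\<in>C0. \<forall>q\<in>B. w c0 q \<le> w c q)"
  using assms
proof (induction B arbitrary: C)
  case empty
  show ?case
  proof (cases "C = {}")
    case False
    then obtain c where "c \<in> C" by blast
    thus ?thesis by (intro exI[of _ "{c}"]) auto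
  qed auto
next
  case (insert x B)
  obtain C0 where C0: "C0 \<subseteq> C" "finite C0" "\<forall>c\<in>C. \<exists>c0\<in>C0. \<forall>q\<in>B. w c0 q \<le> w c q"
    using insert.IH[of C] by blast
  have "\<forall>n. \<exists>D. D \<subseteq> {c\<in>C. w c x = n} \<and> finite D \<and>
      (\<forall>c\<in>{c\<in>C. w c x = n}. \<exists>c0\<in>D. \<forall>q\<in>B. w c0 q \<le> w c q)"
    using insert.IH by blast
  from choice[OF this] obtain D where "\<forall>n. D n \<subseteq> {c\<in>C. w c x = n} \<and> finite (D n) \<and>
      (\<forall>c\<in>{c\<in>C. w c x = n}. \<exists>c0\<in>D n. \<forall>q\<in>B. w c0 q \<le> w c q)" ..
  hence D: "D n \<subseteq> {c\<in>C. w c x = n}" "finite (D n)"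
    "\<forall>c\<in>{c\<in>C. w c x = n}. \<exists>c0\<in>D n. \<forall>q\<in>B. w c0 q \<le> w c q" for n
    by blast+
  define N where "N = (\<Sum>c\<in>C0. w c x)"
  have N: "w c x \<le> N" if "c \<in> C0" for c
    unfolding N_def using that C0(2) by (intro member_le_sum) auto
  have "\<exists>c0\<in>C0 \<union> (\<Union>n<N. D n). \<forall>q\<in>insert x B. w c0 q \<le> w c q" if c: "c \<in> C" for c
  proof (cases "w c x < N")
    case True
    obtain c0 where "c0 \<in> D (w c x)" "\<forall>q\<in>B. w c0 q \<le> w c q" using D(3)[of "w c x"] c by blast
    moreover from this have "w c0 x = w c x" using D(1) by blast
    ultimately show ?thesis using True by (intro bexI[of _ c0]) auto
  next
    case False
    obtain c0 where "c0 \<in> C0" "\<forall>q\<in>B. w c0 q \<le> w c q" using C0(3) c by blast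
    thus ?thesis using False N[of c0] by (intro bexI[of _ c0]) auto
  qed
  moreover have "C0 \<union> (\<Union>n<N. D n) \<subseteq> C" using C0 D(1) by blast
  moreover have "finite (C0 \<union> (\<Union>n<N. D n))" using C0 D by blast
  ultimately show ?case by blast
qed

lemma exists_essential_subset:
  fixes w :: "'c \<Rightarrow> 'b \<Rightarrow> nat"
  assumes "finite B" "C \<noteq> {}"
  shows "\<exists>C0\<subseteq>C. finite C0 \<and> C0 \<noteq> {} \<and>
    (\<forall>k. \<forall>c\<in>C. \<exists>c0\<in>C0. (\<Sum>q\<in>B. k q * w c0 q) \<le> (\<Sum>q\<in>B. k q * w c q)) \<and>
    (\<forall>c\<in>C0. \<exists>k. (\<forall>q. k q > 0) \<and>
       (\<forall>d\<in>C0 - {c}. (\<Sum>q\<in>B. k q * w c q) < (\<Sum>q\<in>B. k q * w d q)))"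
proof -
  define \<sigma> where "\<sigma> = (\<lambda>k c. \<Sum>q\<in>B. k q * w c q)"
  define suff where "suff = (\<lambda>C0. C0 \<subseteq> C \<and> finite C0 \<and> (\<forall>k. \<forall>c\<in>C. \<exists>c0\<in>C0. \<sigma> k c0 \<le> \<sigma> k c))"
  obtain D where D: "D \<subseteq> C" "finite D" "\<forall>c\<in>C. \<exists>d\<in>D. \<forall>q\<in>B. w d q \<le> w c q"
    using dickson[OF assms(1), of C w] by blast
  have "suff D"
    unfolding suff_def
  proof (intro conjI allI ballI)
    fix k c assume "c \<in> C"
    then obtain d where "d \<in> D" "\<forall>q\<in>B. w d q \<le> w c q" using D by blast
    thus "\<exists>d\<in>D. \<sigma> k d \<le> \<sigma> k c"
      unfolding \<sigma>_def by (intro bexI[of _ d] sum_mono) auto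
  qed (use D in auto)
  then obtain C0 where C0: "suff C0" "\<And>E. suff E \<Longrightarrow> card C0 \<le> card E"
    using ex_has_least_nat[of suff D card] by blast
  have "C0 \<noteq> {}" using C0(1) assms(2) unfolding suff_def by blast
  moreover have "\<exists>k. (\<forall>q. k q > 0) \<and> (\<forall>d\<in>C0 - {c}. \<sigma> k c < \<sigma> k d)" if c: "c \<in> C0" for c
  proof -
    have "card (C0 - {c}) < card C0"
      using c C0(1) unfolding suff_def by (intro card_Diff1_less) auto
    hence "\<not> suff (C0 - {c})" using C0(2) leD by blast
    then obtain k e where ke: "e \<in> C" "\<forall>d\<in>C0 - {c}. \<sigma> k e < \<sigma> k d"
      using C0(1) unfolding suff_def by (auto simp: not_le)
    obtain d where d: "d \<in> C0" "\<sigma> k d \<le> \<sigma> k e" using C0(1) ke(1) unfolding suff_def by blast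
    have "d = c"
    proof (rule ccontr)
      assume "d \<noteq> c"
      hence "\<sigma> k e < \<sigma> k d" using ke(2) d(1) by blast
      thus False using d(2) by simp
    qed
    hence less: "\<sigma> k c < \<sigma> k d'" if "d' \<in> C0 - {c}" for d'
    proof -
      have "\<sigma> k e < \<sigma> k d'" using ke(2) that by blast
      thus ?thesis using d(2) \<open>d = c\<close> by simp
    qed
    \<comment> \<open>The gap between c and any other member becomes at least T after scaling by T.
      Adding 1 to every coefficient raises the value at c by less than T, so positivity is gained
      and strictness kept.\<close>
    define T where "T = Suc (\<Sum>q\<in>B. w c q)"
    have \<sigma>_eq: "\<sigma> (\<lambda>q. T * k q + 1) d = T * \<sigma> k d + (\<Sum>q\<in>B. w d q)" for d
      unfolding \<sigma>_def by (simp add: sum_distrib_left sum.distrib algebra_simps)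
    have "\<sigma> (\<lambda>q. T * k q + 1) c < \<sigma> (\<lambda>q. T * k q + 1) d" if "d \<in> C0 - {c}" for d
    proof -
      have "T * \<sigma> k c + T \<le> T * \<sigma> k d"
        using mult_le_mono2[of "Suc (\<sigma> k c)" "\<sigma> k d" T] less[OF that] by simp
      moreover have "(\<Sum>q\<in>B. w c q) < T" by (simp add: T_def)
      ultimately show ?thesis unfolding \<sigma>_eq by linarith
    qed
    thus ?thesis by (intro exI[of _ "\<lambda>q. T * k q + 1"]) simp
  qed
  ultimately show ?thesis
    using C0(1) unfolding suff_def \<sigma>_def by (intro exI[of _ C0] conjI) simp_all
qed

subsection \<open>Factorization of polynomials over a factorial domain\<close>

lemma prime_elem_dvd_prodD:
  assumes "prime_elem p" "p dvd prod g A"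
  shows "\<exists>x\<in>A. p dvd g x"
  using assms(2)
proof (induction A rule: infinite_finite_induct)
  case (insert x A)
  thus ?case using prime_elem_dvd_multD[OF assms(1)] by auto
qed (use assms in \<open>auto simp: prime_elem_def\<close>)

text \<open>Each prime of the product divides g or h and is cancelled there; those going to g form
  \<open>A'\<close>. Only cancellation is used, so this works in any domain.\<close>

lemma divisor_of_prime_product:
  fixes g :: "'m::idom"
  assumes "\<forall>x\<in>#A. prime_elem x" "g * h = u * prod_mset A" "u dvd 1"
  shows "\<exists>A' w. A' \<subseteq># A \<and> w dvd 1 \<and> g = w * prod_mset A'"
  using assms(1,2)
proof (induction A arbitrary: g h)
  case empty
  hence "g dvd 1" using assms(3) by (auto dest: dvd_mult_left)
  thus ?case by (intro exI[of _ "{#}"] exI[of _ g]) simp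
next
  case (add x A)
  have x: "prime_elem x" "x \<noteq> 0" using add.prems by auto
  have "x dvd g * h" unfolding add.prems(2) by simp
  then consider "x dvd g" | "x dvd h" using x prime_elem_dvd_multD by blast
  thus ?case
  proof cases
    case 1
    then obtain g' where g': "g = x * g'" by auto
    have "x * (g' * h) = x * (u * prod_mset A)" using add.prems g' by (simp add: ac_simps)
    hence "g' * h = u * prod_mset A" using x by simp
    then obtain A' w where "A' \<subseteq># A" "w dvd 1" "g' = w * prod_mset A'"
      using add.IH add.prems(1) by (metis union_single_eq_member insert_iff set_mset_add_mset_insert)
    thus ?thesis using g' by (intro exI[of _ "add_mset x A'"] exI[of _ w]) (auto simp: ac_simps)
  next
    case 2
    then obtain h' where h': "h = x * h'" by auto
    have "x * (g * h') = x * (u * prod_mset A)" using add.prems h' by (simp add: ac_simps)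
    hence "g * h' = u * prod_mset A" using x by simp
    then obtain A' w where "A' \<subseteq># A" "w dvd 1" "g = w * prod_mset A'"
      using add.IH add.prems(1) by (metis union_single_eq_member insert_iff set_mset_add_mset_insert)
    thus ?thesis by (intro exI[of _ A'] exI[of _ w]) (auto intro: subset_mset.order_trans)
  qed
qed

lemma fract_cases:
  obtains a b where "b \<noteq> 0" "x = to_fract a / to_fract b"
  by (cases x) (use that in \<open>auto simp: Fract_conv_to_fract\<close>)

lemma clear_denominators:
  fixes g :: "'a::idom fract poly"
  shows "\<exists>b h. b \<noteq> 0 \<and> smult (to_fract b) g = fract_poly h"
proof (induction g)
  case (pCons x g)
  then obtain b h where bh: "b \<noteq> 0" "smult (to_fract b) g = fract_poly h" by blast
  obtain c d where cd: "d \<noteq> 0" "x = to_fract c / to_fract d" by (rule fract_cases)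
  have "smult (to_fract (b * d)) (pCons x g) = fract_poly (pCons (b * c) (smult d h))"
    using bh cd by (simp add: map_poly_pCons smult_smult[symmetric] mult.commute[of _ "to_fract d"] del: smult_smult)
  thus ?case using bh cd by (intro exI[of _ "b * d"] exI[of _ "pCons (b * c) (smult d h)"] conjI) simp_all
qed (auto intro: exI[of _ 1])

text \<open>For nonzero h over a factorial domain: the content is a unit, phrased without greatest
  common divisors.\<close>

definition primitive :: "'a::idom poly \<Rightarrow> bool" where
  "primitive h \<longleftrightarrow> (\<forall>p. prime_elem p \<longrightarrow> \<not> [:p:] dvd h)"

text \<open>Pulling out a constant prime removes one prime factor from the leading coefficient, so
  the process stops.\<close>

lemma split_content:
  fixes h :: "'a::{factorial_semiring, idom} poly"
  assumes "h \<noteq> 0"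
  shows "\<exists>a h'. a \<noteq> 0 \<and> h = smult a h' \<and> primitive h'"
  using assms
proof (induction "size (prime_factorization (lead_coeff h))" arbitrary: h rule: less_induct)
  case less
  show ?case
  proof (cases "primitive h")
    case True
    thus ?thesis by (intro exI[of _ 1] exI[of _ h]) auto
  next
    case False
    then obtain p h1 where p: "prime_elem p" "h = smult p h1" unfolding primitive_def dvd_def by auto
    hence h1: "h1 \<noteq> 0" using less.prems by auto
    have "prime_factorization (lead_coeff h) = prime_factorization p + prime_factorization (lead_coeff h1)"
      using p h1 by (simp add: prime_factorization_mult)
    hence "size (prime_factorization (lead_coeff h1)) < size (prime_factorization (lead_coeff h))"
      using p(1) by (simp add: prime_factorization_empty_iff nonempty_has_size[symmetric] prime_elem_not_unit)
    then obtain a h' where "a \<noteq> 0" "h1 = smult a h'" "primitive h'" using less.hyps h1 by blast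
    thus ?thesis using p by (intro exI[of _ "p * a"] exI[of _ h']) auto
  qed
qed

lemma primitive_associate:
  fixes g :: "'a::{factorial_semiring, idom} fract poly"
  assumes "g \<noteq> 0"
  shows "\<exists>h. primitive h \<and> (\<exists>\<kappa>. \<kappa> \<noteq> 0 \<and> g = smult \<kappa> (fract_poly h))"
proof -
  obtain b h where bh: "b \<noteq> 0" "smult (to_fract b) g = fract_poly h"
    using clear_denominators by blast
  have "h \<noteq> 0" using bh assms by (metis fract_poly_eq_0_iff smult_eq_0_iff to_fract_eq_0_iff)
  then obtain a h' where h': "a \<noteq> 0" "h = smult a h'" "primitive h'" using split_content by blast
  have "g = smult (inverse (to_fract b)) (smult (to_fract b) g)" using bh(1) by simp
  also have "\<dots> = smult (inverse (to_fract b) * to_fract a) (fract_poly h')"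
    unfolding bh(2) h'(2) by simp
  finally show ?thesis using h' bh(1) by (intro exI[of _ h']) (auto intro!: exI)
qed

text \<open>Gauss's lemma, in the form that avoids greatest common divisors of coefficients.\<close>

lemma primitive_cancel:
  fixes f P :: "'a::{factorial_semiring, idom} poly"
  assumes "b \<noteq> 0" "smult b f = smult a P" "primitive P"
  shows "\<exists>c. f = smult c P"
  using assms(1,2)
proof (induction b arbitrary: a rule: prime_divisors_induct)
  case (unit b)
  then obtain u where u: "1 = b * u" by auto
  have "f = smult u (smult b f)" using u by (simp add: mult.commute)
  thus ?case unfolding unit by auto
next
  case (factor p b)
  have p: "prime_elem p" "p \<noteq> 0" using factor(1) by auto
  have *: "smult p (smult b f) = smult a P" using factor.prems by simp
  have "[:a:] * P = [:p:] * smult b f" using * by (simp add: mult.commute)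
  hence "[:p:] dvd [:a:] * P" by (rule dvdI)
  \<comment> \<open>A constant prime stays prime in the polynomial ring and does not divide P, so it
    divides a and can be cancelled on both sides.\<close>
  hence "[:p:] dvd [:a:]"
    using prime_elem_dvd_multD[OF lift_prime_elem_poly[OF p(1)]] assms(3) p(1)
    unfolding primitive_def by blast
  then obtain a' where "a = p * a'" by auto
  hence "smult p (smult b f - smult a' P) = 0" using * by (simp add: smult_diff_right)
  hence "smult b f = smult a' P" using p(2) by simp
  thus ?case using factor.IH factor.prems by auto
qed simp

text \<open>A prime constant dividing the product would divide one of the factors.\<close>

lemma primitive_prod_mset:
  fixes A :: "'a::{factorial_semiring, idom} poly multiset"
  shows "(\<And>q. q \<in># A \<Longrightarrow> primitive q) \<Longrightarrow> primitive (prod_mset A)"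
proof (induction A)
  case empty
  show ?case unfolding primitive_def by (auto simp: is_unit_const_poly_iff prime_elem_def)
next
  case (add q A)
  thus ?case unfolding primitive_def using prime_elem_dvd_multD[OF lift_prime_elem_poly]
    by (metis prod_mset.add_mset union_single_eq_member insert_iff set_mset_add_mset_insert)
qed

lemma prime_elem_smult_iff:
  fixes p :: "'k::field poly"
  assumes "c \<noteq> 0"
  shows "prime_elem (smult c p) \<longleftrightarrow> prime_elem p"
  using assms by (simp add: prime_elem_def smult_dvd_iff)

lemma associated_monic_eq:
  fixes x y :: "'k::field poly"
  assumes "x dvd y" "irreducible y" "\<not> x dvd 1" "lead_coeff x = 1" "lead_coeff y = 1"
  shows "x = y"
proof -
  obtain z where z: "y = x * z" using assms(1) by auto
  hence "z dvd 1" using assms(2,3) irreducibleD by blast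
  then obtain c where "z = [:c:]" by (elim is_unit_polyE)
  moreover from this have "c = 1" using z assms(4,5) by (metis lead_coeff_mult lead_coeff_pCons(2) mult_1)
  ultimately show ?thesis using z by simp
qed

text \<open>The factorization over the quotient field is moved to R by choosing a primitive
  representative of each prime factor. Clearing denominators leaves b times f equal to a times a
  primitive product, and \<open>primitive_cancel\<close> puts the remaining constant into R.\<close>

lemma primitive_factorization:
  fixes f :: "'a::{factorial_semiring, idom} poly"
  assumes "f \<noteq> 0"
  shows "\<exists>c A. c \<noteq> 0 \<and> f = smult c (prod_mset A) \<and> (\<forall>q\<in>#A. prime_elem (fract_poly q)) \<and>
    (\<forall>q\<in>#A. \<forall>q'\<in>#A. fract_poly q dvd fract_poly q' \<longrightarrow> q = q')"
proof -
  define monic where "monic = (\<lambda>x::'a fract poly. smult (inverse (lead_coeff x)) x)"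
  obtain G where G: "prod_mset G = monic (fract_poly f)" "\<And>x. x \<in># G \<Longrightarrow> prime_elem x"
    using field_poly_prod_mset_prime_factorization[of "fract_poly f"] assms
      field_poly_in_prime_factorization_imp_prime[of _ "fract_poly f"]
    unfolding monic_def by auto
  have monic: "lead_coeff (monic x) = 1" "x = smult (lead_coeff x) (monic x)" if "x \<noteq> 0" for x
    using that by (simp_all add: monic_def)
  have "\<forall>x::'a fract poly. \<exists>h. x \<noteq> 0 \<longrightarrow> primitive h \<and> (\<exists>\<kappa>. \<kappa> \<noteq> 0 \<and> x = smult \<kappa> (fract_poly h))"
    using primitive_associate by blast
  from choice[OF this] obtain \<rho> :: "'a fract poly \<Rightarrow> 'a poly" where
    "\<forall>x. x \<noteq> 0 \<longrightarrow> primitive (\<rho> x) \<and> (\<exists>\<kappa>. \<kappa> \<noteq> 0 \<and> x = smult \<kappa> (fract_poly (\<rho> x)))" ..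
  hence \<rho>: "primitive (\<rho> x)" "\<exists>\<kappa>. \<kappa> \<noteq> 0 \<and> x = smult \<kappa> (fract_poly (\<rho> x))" if "x \<noteq> 0" for x
    using that by blast+
  \<comment> \<open>The representative is chosen after passing to the monic multiple, so that
    associated prime factors receive the same one.\<close>
  define \<pi> where "\<pi> = (\<lambda>x. \<rho> (monic x))"
  have \<pi>: "primitive (\<pi> x)" "\<exists>\<kappa>. \<kappa> \<noteq> 0 \<and> monic x = smult \<kappa> (fract_poly (\<pi> x))"
    "\<exists>\<kappa>. \<kappa> \<noteq> 0 \<and> x = smult \<kappa> (fract_poly (\<pi> x))" if "x \<noteq> 0" for x
  proof -
    have m: "monic x \<noteq> 0" using monic(2)[OF that] that by auto
    thus "primitive (\<pi> x)" "\<exists>\<kappa>. \<kappa> \<noteq> 0 \<and> monic x = smult \<kappa> (fract_poly (\<pi> x))"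
      using \<rho> unfolding \<pi>_def by blast+
    then obtain \<kappa> where "\<kappa> \<noteq> 0" "monic x = smult \<kappa> (fract_poly (\<pi> x))" by blast
    thus "\<exists>\<kappa>. \<kappa> \<noteq> 0 \<and> x = smult \<kappa> (fract_poly (\<pi> x))"
      using monic(2)[OF that] that
      by (intro exI[of _ "lead_coeff x * \<kappa>"]) (metis leading_coeff_0_iff mult_eq_0_iff smult_smult)
  qed
  define A where "A = image_mset \<pi> G"
  have G0: "x \<noteq> 0" if "x \<in># G" for x using G(2)[OF that] by auto
  have "\<exists>\<kappa>. \<kappa> \<noteq> 0 \<and> prod_mset G' = smult \<kappa> (fract_poly (prod_mset (image_mset \<pi> G')))"
    if "\<forall>x\<in>#G'. x \<noteq> 0" for G'
    using that
  proof (induction G')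
    case (add x G')
    then obtain \<kappa> where \<kappa>: "\<kappa> \<noteq> 0" "prod_mset G' = smult \<kappa> (fract_poly (prod_mset (image_mset \<pi> G')))"
      by auto
    obtain l where l: "l \<noteq> 0" "x = smult l (fract_poly (\<pi> x))" using \<pi>(3)[of x] add.prems by auto
    have "prod_mset (add_mset x G') = smult l (fract_poly (\<pi> x)) * prod_mset G'" using l(2) by simp
    also have "\<dots> = smult (l * \<kappa>) (fract_poly (prod_mset (image_mset \<pi> (add_mset x G'))))"
      using \<kappa>(2) by (simp add: mult.commute)
    finally show ?case using \<kappa> l by (intro exI[of _ "l * \<kappa>"]) simp
  qed (auto intro: exI[of _ 1])
  then obtain \<kappa> where \<kappa>: "\<kappa> \<noteq> 0" "monic (fract_poly f) = smult \<kappa> (fract_poly (prod_mset A))"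
    using G(1) G0 unfolding A_def by metis
  have "fract_poly f = smult (lead_coeff (fract_poly f) * \<kappa>) (fract_poly (prod_mset A))"
    using monic(2)[of "fract_poly f"] \<kappa>(2) assms by (metis fract_poly_eq_0_iff smult_smult)
  moreover obtain a b where ab: "b \<noteq> 0" "lead_coeff (fract_poly f) * \<kappa> = to_fract a / to_fract b"
    by (rule fract_cases)
  ultimately have "smult (to_fract b) (fract_poly f) = smult (to_fract a) (fract_poly (prod_mset A))"
    by (metis nonzero_eq_divide_eq mult.commute smult_smult to_fract_eq_0_iff)
  hence "smult b f = smult a (prod_mset A)" by (metis fract_poly_eq_iff fract_poly_smult)
  moreover have "primitive (prod_mset A)"
    using \<pi>(1) G0 unfolding A_def by (intro primitive_prod_mset) auto
  ultimately obtain c where c: "f = smult c (prod_mset A)" using primitive_cancel ab(1) by blast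
  moreover have "c \<noteq> 0" using c assms by auto
  moreover have "prime_elem (fract_poly (\<pi> x))" if x: "x \<in># G" for x
  proof -
    obtain l where l: "l \<noteq> 0" "x = smult l (fract_poly (\<pi> x))" using \<pi>(3)[OF G0[OF x]] by blast
    thus ?thesis using G(2)[OF x] by (metis prime_elem_smult_iff)
  qed
  moreover have "\<pi> x = \<pi> y"
    if xy: "x \<in># G" "y \<in># G" and dvd: "fract_poly (\<pi> x) dvd fract_poly (\<pi> y)" for x y
  proof -
    obtain k where k: "k \<noteq> 0" "monic x = smult k (fract_poly (\<pi> x))"
      using \<pi>(2)[OF G0[OF xy(1)]] by blast
    obtain l where l: "l \<noteq> 0" "monic y = smult l (fract_poly (\<pi> y))"
      using \<pi>(2)[OF G0[OF xy(2)]] by blast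
    have ass: "monic z dvd z" "z dvd monic z" if "z \<noteq> 0" for z
      using that by (simp_all add: monic_def smult_dvd_iff dvd_smult)
    have "monic x dvd monic y" unfolding k l using dvd k l by (simp add: smult_dvd_iff dvd_smult)
    moreover have "prime_elem (monic y)"
      using G(2)[OF xy(2)] G0[OF xy(2)] by (simp add: monic_def prime_elem_smult_iff)
    hence "irreducible (monic y)" by (rule prime_elem_imp_irreducible)
    moreover have "\<not> monic x dvd 1"
      using G(2)[OF xy(1)] ass(2)[OF G0[OF xy(1)]] dvd_trans unfolding prime_elem_def by blast
    ultimately have "monic x = monic y" using associated_monic_eq monic(1) G0 xy by blast
    thus ?thesis by (simp add: \<pi>_def)
  qed
  ultimately show ?thesis by (intro exI[of _ c] exI[of _ A]) (auto simp: A_def)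
qed

subsection \<open>The valuations of a polynomial monoid\<close>

lemma poly_fract_poly [simp]: "poly (fract_poly h) (to_fract c) = to_fract (poly h c)"
  by (induction h) (simp_all add: map_poly_pCons)

lemma diff_dvd_poly_diff:
  fixes G :: "'r::comm_ring_1 poly"
  shows "x - y dvd poly G x - poly G y"
proof (induction G)
  case (pCons a G)
  have "poly (pCons a G) x - poly (pCons a G) y = x * (poly G x - poly G y) + (x - y) * poly G y"
    by (simp add: algebra_simps)
  thus ?case using pCons.IH by simp
qed simp

lemma multiplicity_associated:
  fixes p q :: "'a::factorial_semiring"
  assumes "p dvd q" "q dvd p"
  shows "multiplicity p x = multiplicity q x"
proof -
  have "p ^ n dvd x \<longleftrightarrow> q ^ n dvd x" for n
    using assms by (meson dvd_power_same dvd_trans)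
  thus ?thesis unfolding multiplicity_def by simp
qed

lemma infinite_powers_prime_elem:
  fixes p :: "'a::factorial_semiring"
  assumes "prime_elem p"
  shows "infinite ((\<lambda>n. p ^ n) ` {m..})"
proof -
  have "inj (\<lambda>n. p ^ n)"
    by (rule inj_on_inverseI[of _ "multiplicity p"]) (use assms in simp)
  hence "inj_on (\<lambda>n. p ^ n) {m..}" by (rule inj_on_subset) simp
  thus ?thesis using finite_imageD[of "\<lambda>n. p ^ n" "{m..}"] infinite_Ici[of m] by blast
qed

section \<open>The p-adic valuation of the quotient field\<close>

definition fract_val :: "'a::{factorial_semiring, idom} \<Rightarrow> 'a fract \<Rightarrow> int" where
  "fract_val p = quot_val (UNIV - {0}) (multiplicity p)"

lemma additive_valuation_multiplicity:
  "prime_elem p \<Longrightarrow> additive_valuation (UNIV - {0}) (multiplicity (p :: 'a::{factorial_semiring, idom}))"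
  by unfold_locales (auto simp: prime_elem_multiplicity_mult_distrib)

lemma quot_group_nonzero_elements: "quot_group (UNIV - {0 :: 'a::idom}) = UNIV - {0}"
proof (intro Set.set_eqI iffI)
  fix x :: "'a fract" assume x: "x \<in> UNIV - {0}"
  obtain a b where "b \<noteq> 0" "x = to_fract a / to_fract b" by (rule fract_cases)
  thus "x \<in> quot_group (UNIV - {0})" using x unfolding quot_group_def by fastforce
qed (auto simp: quot_group_def)

lemma fract_val_to_fract: "prime_elem p \<Longrightarrow> a \<noteq> 0 \<Longrightarrow> fract_val p (to_fract a) = int (multiplicity p a)"
  unfolding fract_val_def using additive_valuation.quot_val_to_fract[OF additive_valuation_multiplicity] by auto

lemma fract_val_mult: "prime_elem p \<Longrightarrow> x \<noteq> 0 \<Longrightarrow> y \<noteq> 0 \<Longrightarrow> fract_val p (x * y) = fract_val p x + fract_val p y"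
  unfolding fract_val_def using additive_valuation.quot_val_mult[OF additive_valuation_multiplicity, of p x y]
  by (simp add: quot_group_nonzero_elements)

lemma fract_val_inverse: "prime_elem p \<Longrightarrow> x \<noteq> 0 \<Longrightarrow> fract_val p (inverse x) = - fract_val p x"
  unfolding fract_val_def using additive_valuation.quot_val_inverse[OF additive_valuation_multiplicity, of p x]
  by (simp add: quot_group_nonzero_elements)

lemma fract_val_divide: "prime_elem p \<Longrightarrow> x \<noteq> 0 \<Longrightarrow> y \<noteq> 0 \<Longrightarrow> fract_val p (x / y) = fract_val p x - fract_val p y"
  by (simp add: divide_inverse fract_val_mult fract_val_inverse)

lemma fract_val_nonneg: "prime_elem p \<Longrightarrow> x \<in> range to_fract \<Longrightarrow> x \<noteq> 0 \<Longrightarrow> fract_val p x \<ge> 0"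
  by (auto simp: fract_val_to_fract)

text \<open>The polynomial is given by its factorization, with the exponents as multiplicities in
  \<open>A\<close>; every power of f is then visibly a monomial in the factors.\<close>

locale factored_polynomial =
  fixes c0 :: "'a::{factorial_semiring, idom}" and A :: "'a poly multiset" and Q :: "'a set"
  assumes c0: "c0 \<noteq> 0"
    and prime_factor: "q \<in># A \<Longrightarrow> prime_elem (fract_poly q)"
    and nonassociated: "q \<in># A \<Longrightarrow> q' \<in># A \<Longrightarrow> fract_poly q dvd fract_poly q' \<Longrightarrow> q = q'"
    and Q: "prime_representatives Q"
begin

definition f :: "'a poly" where "f = smult c0 (prod_mset A)"

abbreviation "B \<equiv> set_mset A"

abbreviation "H \<equiv> monadic (fract_poly f)"

definition monomial :: "'a fract \<Rightarrow> ('a poly \<Rightarrow> nat) \<Rightarrow> 'a fract poly" where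
  "monomial \<kappa> k = smult \<kappa> (\<Prod>q\<in>B. fract_poly q ^ k q)"

lemma factor_nonzero: "q \<in> B \<Longrightarrow> q \<noteq> 0"
  using prime_factor[of q] by auto

lemma f_nonzero: "f \<noteq> 0"
  using c0 factor_nonzero by (auto simp: f_def)

lemma prime_Q: "p \<in> Q \<Longrightarrow> prime_elem p"
  using Q unfolding prime_representatives_def by blast

lemma Q_unique: "p \<in> Q \<Longrightarrow> q \<in> Q \<Longrightarrow> p dvd q \<Longrightarrow> p = q"
proof -
  assume *: "p \<in> Q" "q \<in> Q" "p dvd q"
  obtain r where r: "q = p * r" using *(3) by auto
  have "irreducible q" using prime_Q *(2) prime_elem_imp_irreducible by blast
  hence "r dvd 1" using r irreducibleD prime_elem_not_unit prime_Q *(1) by blast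
  hence "q dvd p" using r by simp
  moreover have "\<exists>!q. q \<in> Q \<and> p dvd q \<and> q dvd p"
    using Q prime_Q[OF *(1)] unfolding prime_representatives_def by simp
  ultimately show "p = q" using * dvd_refl[of p] by (elim ex1E) metis
qed

lemma Q_representative: "prime_elem p \<Longrightarrow> \<exists>q\<in>Q. p dvd q \<and> q dvd p"
  using Q unfolding prime_representatives_def by (meson ex1_implies_ex)

lemma multiplicity_Q: "p \<in> Q \<Longrightarrow> q \<in> Q \<Longrightarrow> multiplicity p q = (if p = q then 1 else 0)"
  using Q_unique[of p q] prime_Q by (auto intro: not_dvd_imp_multiplicity_0)

text \<open>A factorial domain is the intersection of its localizations at primes: nonnegative
  valuations mean that the denominator divides the numerator.\<close>

lemma integralI:
  assumes "x \<noteq> 0" "\<And>p. p \<in> Q \<Longrightarrow> fract_val p x \<ge> 0"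
  shows "x \<in> range to_fract"
proof -
  obtain a b where ab: "b \<noteq> 0" "x = to_fract a / to_fract b" by (rule fract_cases)
  hence a: "a \<noteq> 0" using assms(1) by auto
  have "b dvd a"
  proof (rule multiplicity_le_imp_dvd[OF ab(1)])
    \<comment> \<open>The normalized primes of the library and the elements of \<open>Q\<close> are
      two systems of representatives; associated primes have equal multiplicities.\<close>
    fix p :: 'a assume "Factorial_Ring.prime p"
    then obtain q where q: "q \<in> Q" "p dvd q" "q dvd p" using Q_representative by blast
    have "multiplicity q b \<le> multiplicity q a"
      using assms(2)[OF q(1)] prime_Q[OF q(1)] ab a by (simp add: fract_val_divide fract_val_to_fract)
    thus "multiplicity p b \<le> multiplicity p a" using multiplicity_associated[OF q(2,3)] by simp
  qed
  thus ?thesis using ab by auto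
qed

text \<open>Distinct elements of \<open>Q\<close> are not associated, so normalization embeds the
  set into the finite set of prime factors of a.\<close>

lemma finite_Q_divisors:
  assumes "a \<noteq> 0"
  shows "finite {p\<in>Q. p dvd a}"
proof (rule finite_imageD)
  show "finite (normalize ` {p\<in>Q. p dvd a})"
    by (rule finite_subset[of _ "prime_factors a"])
       (use assms prime_Q in \<open>auto simp: in_prime_factors_iff\<close>)
  show "inj_on normalize {p\<in>Q. p dvd a}"
  proof (rule inj_onI)
    fix p q assume *: "p \<in> {p\<in>Q. p dvd a}" "q \<in> {p\<in>Q. p dvd a}" "normalize p = normalize q"
    hence "p dvd q" using associatedD1 by blast
    thus "p = q" using * Q_unique by simp
  qed
qed

section \<open>Divisors of powers of f over the quotient field\<close>

lemma monomial_nonzero: "\<kappa> \<noteq> 0 \<Longrightarrow> monomial \<kappa> k \<noteq> 0"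
  using factor_nonzero by (auto simp: monomial_def)

lemma monomial_mult: "monomial \<kappa> k * monomial \<kappa>' k' = monomial (\<kappa> * \<kappa>') (\<lambda>q. k q + k' q)"
  by (simp add: monomial_def power_add prod.distrib mult.commute)

lemma monomial_cong: "(\<And>q. q \<in> B \<Longrightarrow> k q = k' q) \<Longrightarrow> monomial \<kappa> k = monomial \<kappa> k'"
  unfolding monomial_def by (auto intro!: arg_cong2[of _ _ _ _ smult] prod.cong)

text \<open>If the exponent of q on the right were larger, cancelling \<open>k q\<close> copies of q
  would make q divide a product of powers of the other, non-associated primes.\<close>

lemma monomial_exponent_le:
  assumes "\<kappa> \<noteq> 0" "monomial \<kappa> k = monomial \<kappa>' k'" "q \<in> B"
  shows "k' q \<le> k q"
proof (rule ccontr)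
  assume *: "\<not> k' q \<le> k q"
  define R where "R = (\<lambda>k. \<Prod>q'\<in>B - {q}. fract_poly q' ^ k q')"
  have mono_eq: "monomial \<kappa> k = fract_poly q ^ k q * smult \<kappa> (R k)" for \<kappa> k
    unfolding monomial_def R_def using assms(3) by (subst prod.remove[of _ q]) auto
  have "k' q = k q + Suc (k' q - k q - 1)" using * by simp
  hence pow: "F ^ k' q = F ^ k q * (F * F ^ (k' q - k q - 1))" for F :: "'a fract poly"
    by (metis power_Suc power_add)
  have nz: "fract_poly q ^ k q \<noteq> 0" using factor_nonzero[OF assms(3)] by simp
  have "fract_poly q ^ k q * smult \<kappa> (R k) =
      fract_poly q ^ k q * (fract_poly q * (fract_poly q ^ (k' q - k q - 1) * smult \<kappa>' (R k')))"
    using assms(2) unfolding mono_eq pow by (simp only: mult.assoc)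
  hence "smult \<kappa> (R k) = fract_poly q * (fract_poly q ^ (k' q - k q - 1) * smult \<kappa>' (R k'))"
    using nz by (simp only: mult_cancel_left simp_thms)
  hence "fract_poly q dvd smult \<kappa> (R k)" by (rule dvdI)
  hence "fract_poly q dvd R k" using assms(1) by (simp add: dvd_smult_iff)
  then obtain q' where "q' \<in> B - {q}" "fract_poly q dvd fract_poly q' ^ k q'"
    unfolding R_def using prime_elem_dvd_prodD[OF prime_factor[OF assms(3)]] by blast
  thus False using prime_elem_dvd_power[OF prime_factor[OF assms(3)]] nonassociated assms(3) by blast
qed

lemma monomial_unique:
  assumes "\<kappa> \<noteq> 0" "\<kappa>' \<noteq> 0" "monomial \<kappa> k = monomial \<kappa>' k'"
  shows "\<kappa> = \<kappa>'" "q \<in> B \<Longrightarrow> k q = k' q"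
proof -
  have *: "k q = k' q" if "q \<in> B" for q
    using monomial_exponent_le[of \<kappa> k \<kappa>' k' q] monomial_exponent_le[of \<kappa>' k' \<kappa> k q] assms that by simp
  thus "q \<in> B \<Longrightarrow> k q = k' q" .
  have "monomial \<kappa> k = monomial \<kappa>' k" using assms(3) * monomial_cong[of k k'] by metis
  hence "smult (\<kappa> - \<kappa>') (\<Prod>q\<in>B. fract_poly q ^ k q) = 0" unfolding monomial_def by (simp add: smult_diff_left)
  thus "\<kappa> = \<kappa>'" using factor_nonzero by simp
qed

lemma fract_poly_power: "fract_poly (h ^ n) = fract_poly h ^ n"
  by (induction n) auto

lemma fract_poly_f_power: "fract_poly f ^ N = monomial (to_fract c0 ^ N) (\<lambda>q. N * count A q)"
proof -
  have "fract_poly (\<Prod>q\<in>S. q ^ n q) = (\<Prod>q\<in>S. fract_poly q ^ n q)" for S and n :: "'a poly \<Rightarrow> nat"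
    by (induction S rule: infinite_finite_induct) (simp_all add: fract_poly_power)
  hence "fract_poly (prod_mset A) = (\<Prod>q\<in>B. fract_poly q ^ count A q)"
    unfolding prod_mset_multiplicity .
  thus ?thesis
    unfolding monomial_def f_def
    by (simp add: smult_power prod_power_distrib power_mult mult.commute[of N])
qed

text \<open>Over the field, \<open>c0\<close> is a unit and the factors are prime, so a divisor is a
  unit, that is a nonzero constant, times a product of some of the factors of
  \<open>f ^ N\<close>.\<close>

lemma divisor_monomial:
  assumes "fract_poly f ^ N = g * h"
  shows "\<exists>\<kappa> k. \<kappa> \<noteq> 0 \<and> g = monomial \<kappa> k"
proof -
  define AA where "AA = repeat_mset N (image_mset fract_poly A)"
  have "prod_mset (repeat_mset N X) = prod_mset X ^ N" for X :: "'a fract poly multiset"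
    by (induction N) (auto simp: repeat_mset_Suc)
  hence "prod_mset AA = fract_poly (prod_mset A) ^ N"
    unfolding AA_def using prod_mset_fract_poly[of "\<lambda>x. x" A] by simp
  hence "g * h = [:to_fract c0 ^ N:] * prod_mset AA"
    using assms unfolding f_def by (simp add: smult_power mult.commute)
  moreover have "[:to_fract c0 ^ N:] dvd 1" using c0 by (simp add: is_unit_const_poly_iff dvd_field_iff)
  moreover have AA_sub: "set_mset AA \<subseteq> fract_poly ` B"
  proof
    fix x assume "x \<in># AA"
    hence "0 < count AA x" by (simp only: count_greater_zero_iff)
    hence "0 < N * count (image_mset fract_poly A) x" unfolding AA_def count_repeat_mset .
    hence "x \<in># image_mset fract_poly A" by simp
    thus "x \<in> fract_poly ` B" by simp
  qed
  moreover from this have "\<forall>x\<in>#AA. prime_elem x" using prime_factor by blast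
  ultimately obtain A' w where A': "A' \<subseteq># AA" "w dvd 1" "g = w * prod_mset A'"
    using divisor_of_prime_product[of AA g h] by blast
  obtain \<kappa> where \<kappa>: "w = [:\<kappa>:]" "\<kappa> \<noteq> 0"
    using A'(2) by (elim is_unit_polyE) (metis dvd_0_left_iff zero_neq_one)
  have "prod_mset A' = (\<Prod>x\<in>fract_poly ` B. x ^ count A' x)"
    unfolding prod_mset_multiplicity
    using set_mset_mono[OF A'(1)] AA_sub
    by (intro prod.mono_neutral_left) (auto simp: not_in_iff)
  also have "\<dots> = (\<Prod>q\<in>B. fract_poly q ^ count A' (fract_poly q))"
    by (subst prod.reindex) (auto intro: inj_onI)
  finally show ?thesis using A'(3) \<kappa>
    by (intro exI[of _ \<kappa>] exI[of _ "\<lambda>q. count A' (fract_poly q)"]) (simp add: monomial_def)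
qed

section \<open>Values outside the roots of f\<close>

definition nonroots :: "'a set" where "nonroots = {c. poly f c \<noteq> 0}"

text \<open>For c in \<open>nonroots\<close>, the p-adic valuation at c of the product of the powers
  \<open>q ^ k q\<close>. Each c thus yields one linear form in the exponents.\<close>

definition weight :: "'a \<Rightarrow> ('a poly \<Rightarrow> nat) \<Rightarrow> 'a \<Rightarrow> nat" where
  "weight p k c = (\<Sum>q\<in>B. k q * multiplicity p (poly q c))"

lemma weight_add: "weight p (\<lambda>q. k q + k' q) c = weight p k c + weight p k' c"
  by (simp add: weight_def sum.distrib algebra_simps)

lemma factor_dvd: "q \<in> B \<Longrightarrow> poly q c dvd poly f c"
  unfolding f_def by (metis dvd_prod_mset dvd_smult poly_mult dvd_def)

lemma factor_eval_nonzero: "q \<in> B \<Longrightarrow> c \<in> nonroots \<Longrightarrow> poly q c \<noteq> 0"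
  using factor_dvd[of q c] by (auto simp: nonroots_def)

lemma poly_monomial: "poly (monomial \<kappa> k) (to_fract c) = \<kappa> * to_fract (\<Prod>q\<in>B. poly q c ^ k q)"
proof -
  have "to_fract (\<Prod>q\<in>S. poly q c ^ k q) = (\<Prod>q\<in>S. to_fract (poly q c) ^ k q)" for S
  proof -
    have "to_fract (x ^ n) = to_fract x ^ n" for x :: 'a and n by (induction n) auto
    thus ?thesis by (induction S rule: infinite_finite_induct) simp_all
  qed
  thus ?thesis by (simp add: monomial_def poly_prod)
qed

lemma fract_val_eval:
  assumes "prime_elem p" "c \<in> nonroots" "\<kappa> \<noteq> 0"
  shows "poly (monomial \<kappa> k) (to_fract c) \<noteq> 0"
    "fract_val p (poly (monomial \<kappa> k) (to_fract c)) = fract_val p \<kappa> + int (weight p k c)"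
proof -
  have nz: "(\<Prod>q\<in>B. poly q c ^ k q) \<noteq> 0" using factor_eval_nonzero assms(2) by simp
  have "multiplicity p (\<Prod>q\<in>B. poly q c ^ k q) = weight p k c"
    unfolding weight_def using assms factor_eval_nonzero
    by (subst prime_elem_multiplicity_prod_distrib)
       (auto simp: prime_elem_multiplicity_power_distrib intro!: sum.cong)
  thus "poly (monomial \<kappa> k) (to_fract c) \<noteq> 0"
    "fract_val p (poly (monomial \<kappa> k) (to_fract c)) = fract_val p \<kappa> + int (weight p k c)"
    unfolding poly_monomial using nz assms by (simp_all add: fract_val_mult fract_val_to_fract)
qed

text \<open>\<open>nonroots\<close> is dense in the \<open>p\<close>-adic topology: \<open>c\<close> is approximated by the elements \<open>c + p ^ m\<close>.\<close>

lemma dense: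
  assumes "prime_elem p" "\<And>c. c \<in> nonroots \<Longrightarrow> p ^ n dvd poly G c"
  shows "p ^ n dvd poly G c"
proof -
  have "infinite ((\<lambda>m. c + p ^ m) ` {n..})"
    using infinite_powers_prime_elem[OF assms(1), of n] finite_imageD[of "(+) c" "(\<lambda>m. p ^ m) ` {n..}"]
    by (auto simp: image_image)
  moreover have "finite {x. poly f x = 0}" by (rule poly_roots_finite[OF f_nonzero])
  ultimately have "\<not> (\<lambda>m. c + p ^ m) ` {n..} \<subseteq> {x. poly f x = 0}" using finite_subset by blast
  then obtain m where m: "m \<ge> n" "c + p ^ m \<in> nonroots" unfolding nonroots_def by auto
  have "p ^ m dvd poly G (c + p ^ m) - poly G c" using diff_dvd_poly_diff[of "c + p ^ m" c G] by simp
  hence "p ^ n dvd poly G (c + p ^ m) - poly G c" using le_imp_power_dvd[OF m(1), of p] by (rule dvd_trans[rotated])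
  from dvd_diff[OF assms(2)[OF m(2)] this] show ?thesis by simp
qed

text \<open>Density applied to the constant 1: without nonroots, p would divide 1. The prime is
  essential, since over a finite field f may vanish everywhere.\<close>

lemma nonroots_nonempty: "prime_elem (p :: 'a) \<Longrightarrow> nonroots \<noteq> {}"
  using dense[of p 1 1 0] prime_elem_not_unit[of p] by auto

text \<open>After clearing a denominator b, integrality at c means that b divides the value there.
  For each prime p the required power of p divides the values on \<open>nonroots\<close>, hence by
  density all values.\<close>

lemma int_valuedI:
  assumes "\<And>c. c \<in> nonroots \<Longrightarrow> poly g (to_fract c) \<in> range to_fract"
  shows "g \<in> int_valued"
  unfolding int_valued_def
proof (intro CollectI allI)
  fix c
  obtain b G where bG: "b \<noteq> 0" "smult (to_fract b) g = fract_poly G" using clear_denominators by blast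
  have G: "to_fract (poly G c) = to_fract b * poly g (to_fract c)" for c
    by (simp flip: poly_fract_poly bG(2))
  have "b dvd poly G c"
  proof (cases "poly G c = 0")
    case False
    show ?thesis
    proof (rule multiplicity_le_imp_dvd[OF bG(1)])
      fix p :: 'a assume "Factorial_Ring.prime p"
      hence p: "prime_elem p" by simp
      have "p ^ multiplicity p b dvd poly G c'" if "c' \<in> nonroots" for c'
      proof -
        obtain x where "poly g (to_fract c') = to_fract x" using assms \<open>c' \<in> nonroots\<close> by blast
        hence "poly G c' = b * x" using G[of c'] by (simp flip: to_fract_mult)
        thus ?thesis by (simp add: dvd_mult2 multiplicity_dvd)
      qed
      hence "p ^ multiplicity p b dvd poly G c" using dense p by blast
      thus "multiplicity p b \<le> multiplicity p (poly G c)"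
        using False p prime_elem_not_unit by (intro multiplicity_geI) auto
    qed
  qed simp
  then obtain x where "poly G c = b * x" by auto
  hence "poly g (to_fract c) = to_fract x" using G[of c] bG(1) by simp
  thus "poly g (to_fract c) \<in> range to_fract" by blast
qed

lemma monomial_int_valuedI:
  assumes "\<kappa> \<noteq> 0" "\<And>p c. p \<in> Q \<Longrightarrow> c \<in> nonroots \<Longrightarrow> fract_val p \<kappa> + int (weight p k c) \<ge> 0"
  shows "monomial \<kappa> k \<in> int_valued"
proof (rule int_valuedI)
  fix c assume c: "c \<in> nonroots"
  have "poly (monomial \<kappa> k) (to_fract c) \<noteq> 0"
    using factor_eval_nonzero c assms(1) by (simp add: poly_monomial)
  thus "poly (monomial \<kappa> k) (to_fract c) \<in> range to_fract"
    using assms fract_val_eval(2)[OF prime_Q c assms(1)] c by (intro integralI) auto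
qed

section \<open>Primes dividing all values of f, and membership in H\<close>

definition fixed_primes :: "'a set" where "fixed_primes = {p \<in> Q. \<forall>c. p dvd poly f c}"

lemma fixed_primes_Q: "p \<in> fixed_primes \<Longrightarrow> p \<in> Q"
  by (simp add: fixed_primes_def)

lemma prime_fixed_primes: "p \<in> fixed_primes \<Longrightarrow> prime_elem p"
  using fixed_primes_Q prime_Q by blast

lemma fixed_primes_nonzero: "p \<in> fixed_primes \<Longrightarrow> p \<noteq> 0"
  using prime_fixed_primes[of p] by auto

lemma finite_fixed_primes [simp, intro]: "finite fixed_primes"
proof (cases "fixed_primes = {}")
  case False
  then obtain p where "p \<in> fixed_primes" by blast
  then obtain c where "c \<in> nonroots" using nonroots_nonempty prime_fixed_primes by blast
  hence "finite {p\<in>Q. p dvd poly f c}" by (intro finite_Q_divisors) (simp add: nonroots_def)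
  thus ?thesis by (rule finite_subset[rotated]) (auto simp: fixed_primes_def)
qed auto

lemma multiplicity_prod_fixed_primes:
  assumes "p \<in> Q"
  shows "multiplicity p (\<Prod>q\<in>fixed_primes. q ^ e q) = (if p \<in> fixed_primes then e p else 0)"
proof -
  have "multiplicity p (\<Prod>q\<in>fixed_primes. q ^ e q) = (\<Sum>q\<in>fixed_primes. e q * multiplicity p q)"
    using prime_Q[OF assms] fixed_primes_nonzero
    by (subst prime_elem_multiplicity_prod_distrib)
       (auto simp: prime_elem_multiplicity_power_distrib intro!: sum.cong)
  also have "\<dots> = (\<Sum>q\<in>fixed_primes. if q = p then e q else 0)"
    using multiplicity_Q[OF assms fixed_primes_Q] by (intro sum.cong) auto
  finally show ?thesis by simp
qed

lemma prod_fixed_primes_nonzero: "(\<Prod>q\<in>fixed_primes. q ^ e q) \<noteq> 0"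
  using fixed_primes_nonzero by auto

text \<open>If p does not divide f(c), then c is no root and p divides no q(c), so all forms
  belonging to c vanish.\<close>

lemma Q_witness:
  assumes "p \<in> Q - fixed_primes"
  obtains c where "c \<in> nonroots" "multiplicity p (poly f c) = 0" "\<And>k. weight p k c = 0"
proof -
  obtain c where c: "\<not> p dvd poly f c" using assms unfolding fixed_primes_def by blast
  hence "c \<in> nonroots" by (auto simp: nonroots_def)
  moreover have "weight p k c = 0" for k
    unfolding weight_def using c factor_dvd[of _ c] dvd_trans[of p _ "poly f c"] by (auto intro!: not_dvd_imp_multiplicity_0)
  ultimately show ?thesis using that c not_dvd_imp_multiplicity_0 by blast
qed

text \<open>At a point where p does not divide the value of f, the values of g and its cofactor have
  nonnegative valuations summing to 0. Both are therefore 0, and so is the valuation of the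
  constant.\<close>

lemma monadicE:
  assumes "g \<in> H"
  obtains \<kappa> k where "\<kappa> \<noteq> 0" "g = monomial \<kappa> k" "\<And>p. p \<in> Q - fixed_primes \<Longrightarrow> fract_val p \<kappa> = 0"
proof -
  obtain N h where gh: "g \<in> int_valued" "h \<in> int_valued" "fract_poly f ^ N = g * h"
    using assms unfolding monadic_def by blast
  obtain \<kappa> k where g: "\<kappa> \<noteq> 0" "g = monomial \<kappa> k" using divisor_monomial[OF gh(3)] by blast
  obtain \<kappa>' k' where h: "\<kappa>' \<noteq> 0" "h = monomial \<kappa>' k'" using divisor_monomial[of N h g] gh(3) by (auto simp: mult.commute)
  have "fract_val p \<kappa> = 0" if p: "p \<in> Q - fixed_primes" for p
  proof -
    obtain c where c: "c \<in> nonroots" "multiplicity p (poly f c) = 0" "\<And>k. weight p k c = 0"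
      using Q_witness[OF p] by blast
    have pp: "prime_elem p" using p prime_Q by blast
    have "poly (fract_poly f ^ N) (to_fract c) = to_fract (poly f c ^ N)"
      by (metis fract_poly_power poly_fract_poly poly_power)
    hence "fract_val p (poly (fract_poly f ^ N) (to_fract c)) = 0"
      using c(1,2) pp by (simp add: fract_val_to_fract nonroots_def prime_elem_multiplicity_power_distrib)
    hence "fract_val p (poly g (to_fract c)) + fract_val p (poly h (to_fract c)) = 0"
      using fract_val_eval(1)[OF pp c(1)] g h pp by (simp add: gh(3) fract_val_mult)
    moreover have "fract_val p (poly g (to_fract c)) \<ge> 0" "fract_val p (poly h (to_fract c)) \<ge> 0"
      using gh g h fract_val_eval(1)[OF pp c(1)] unfolding int_valued_def by (auto intro!: fract_val_nonneg[OF pp])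
    ultimately have "fract_val p (poly g (to_fract c)) = 0" by simp
    thus ?thesis using fract_val_eval(2)[OF pp c(1) g(1), of k] c(3) g(2) by simp
  qed
  thus ?thesis using that g by blast
qed

text \<open>Integrality follows from the inequalities; the work lies in finding a power of f whose
  cofactor is integer-valued as well.\<close>

lemma monadicI:
  assumes "\<kappa> \<noteq> 0" "\<And>p. p \<in> Q - fixed_primes \<Longrightarrow> fract_val p \<kappa> = 0"
    "\<And>p c. p \<in> fixed_primes \<Longrightarrow> c \<in> nonroots \<Longrightarrow> fract_val p \<kappa> + int (weight p k c) \<ge> 0"
  shows "monomial \<kappa> k \<in> H"
proof -
  \<comment> \<open>n bounds every exponent on B and the absolute valuation of
    \<open>\<kappa>\<close> at every fixed prime. In \<open>f ^ (2 * n)\<close>, one factor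
    \<open>f ^ n\<close> absorbs the exponents k; the other has valuation at least n at each fixed
    prime, because such a prime divides every value of f, and this compensates
    \<open>\<kappa>\<close>.\<close>
  define n where "n = (\<Sum>q\<in>B. k q) + (\<Sum>p\<in>fixed_primes. nat \<bar>fract_val p \<kappa>\<bar>)"
  define k' where "k' = (\<lambda>q. 2 * n * count A q - k q)"
  define \<kappa>' where "\<kappa>' = to_fract (c0 ^ (2 * n)) / \<kappa>"
  have \<kappa>': "\<kappa>' \<noteq> 0" using c0 assms(1) by (simp add: \<kappa>'_def)
  have k_le: "k q \<le> n" if "q \<in> B" for q
    using member_le_sum[of q B k] that unfolding n_def by simp
  have to_fract_power: "to_fract (c0 ^ N) = to_fract c0 ^ N" for N by (induction N) auto
  have int: "monomial \<kappa> k \<in> int_valued"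
  proof (rule monomial_int_valuedI[OF assms(1)])
    fix p c assume "p \<in> Q" "c \<in> nonroots"
    thus "fract_val p \<kappa> + int (weight p k c) \<ge> 0" using assms(2,3)[of p] by (cases "p \<in> fixed_primes") auto
  qed
  have "monomial \<kappa>' k' \<in> int_valued"
  proof (rule monomial_int_valuedI[OF \<kappa>'])
    fix p c assume pc: "p \<in> Q" "c \<in> nonroots"
    have p: "prime_elem p" using pc prime_Q by blast
    have fract_val\<kappa>': "fract_val p \<kappa>' = int (2 * n * multiplicity p c0) - fract_val p \<kappa>"
      unfolding \<kappa>'_def using c0 assms(1) p
      by (simp add: fract_val_divide fract_val_to_fract prime_elem_multiplicity_power_distrib del: of_nat_mult)
    show "fract_val p \<kappa>' + int (weight p k' c) \<ge> 0"
    proof (cases "p \<in> fixed_primes")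
      case True
      have "multiplicity p (poly f c) = multiplicity p c0 + weight p (count A) c"
      proof -
        have "fract_val p (poly (fract_poly f) (to_fract c)) = fract_val p (to_fract c0) + int (weight p (count A) c)"
          using fract_val_eval(2)[OF p pc(2), of "to_fract c0" "count A"] fract_poly_f_power[of 1] c0 by (simp del: poly_fract_poly)
        hence "fract_val p (to_fract (poly f c)) = fract_val p (to_fract c0) + int (weight p (count A) c)"
          unfolding poly_fract_poly .
        thus ?thesis using p c0 pc(2) by (simp add: fract_val_to_fract nonroots_def)
      qed
      moreover have "multiplicity p (poly f c) > 0"
        using True pc(2) p by (simp add: fixed_primes_def nonroots_def prime_multiplicity_gt_zero_iff)
      ultimately have "n * 1 \<le> n * (multiplicity p c0 + weight p (count A) c)" by (intro mult_le_mono2) linarith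
      hence "n \<le> n * (multiplicity p c0 + weight p (count A) c)" by simp
      also have "\<dots> = n * multiplicity p c0 + weight p (\<lambda>q. n * count A q) c"
        by (simp add: weight_def algebra_simps sum_distrib_left)
      also have "weight p (\<lambda>q. n * count A q) c \<le> weight p k' c"
        unfolding weight_def
      proof (intro sum_mono mult_right_mono)
        fix q assume q: "q \<in> B"
        hence "n \<le> n * count A q" by simp
        moreover have "2 * n * count A q = n * count A q + n * count A q" by simp
        ultimately show "n * count A q \<le> k' q" using k_le[OF q] unfolding k'_def by linarith
      qed auto
      finally have "n \<le> n * multiplicity p c0 + weight p k' c" by simp
      also have "\<dots> \<le> 2 * n * multiplicity p c0 + weight p k' c" by simp
      finally have "int n \<le> int (2 * n * multiplicity p c0) + int (weight p k' c)" by linarith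
      moreover have "fract_val p \<kappa> \<le> int n"
        using member_le_sum[of p fixed_primes "\<lambda>p. nat \<bar>fract_val p \<kappa>\<bar>"] True finite_fixed_primes unfolding n_def by linarith
      ultimately show ?thesis unfolding fract_val\<kappa>' by linarith
    next
      case False
      thus ?thesis using fract_val\<kappa>' assms(2)[of p] pc(1) by simp
    qed
  qed
  moreover have "fract_poly f ^ (2 * n) = monomial \<kappa> k * monomial \<kappa>' k'"
  proof -
    have "k q + k' q = 2 * n * count A q" if q: "q \<in> B" for q
    proof -
      have "n \<le> n * count A q" using q by simp
      moreover have "2 * n * count A q = n * count A q + n * count A q" by simp
      ultimately have "k q \<le> 2 * n * count A q" using k_le[OF q] by linarith
      thus ?thesis unfolding k'_def by simp
    qed
    hence "monomial (\<kappa> * \<kappa>') (\<lambda>q. k q + k' q) = monomial (\<kappa> * \<kappa>') (\<lambda>q. 2 * n * count A q)"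
      by (rule monomial_cong)
    moreover have "\<kappa> * \<kappa>' = to_fract c0 ^ (2 * n)" using assms(1) by (simp add: \<kappa>'_def to_fract_power)
    ultimately show ?thesis
      unfolding fract_poly_f_power monomial_mult by simp
  qed
  ultimately show ?thesis unfolding monadic_def using int monomial_nonzero[OF assms(1)] by blast
qed

lemma monadic_int_valued: "g \<in> H \<Longrightarrow> g \<in> int_valued"
  by (simp add: monadic_def)

sublocale domain_submonoid H
proof
  show "0 \<notin> H" by (simp add: monadic_def)
  show "1 \<in> H" unfolding monadic_def int_valued_def
    by (auto intro!: exI[of _ 0] bexI[of _ 1] image_eqI[of _ _ 1])
  fix a b assume "a \<in> H" "b \<in> H"
  then obtain m n g h where *: "a \<in> int_valued - {0}" "b \<in> int_valued - {0}" "g \<in> int_valued" "h \<in> int_valued"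
    "fract_poly f ^ m = a * g" "fract_poly f ^ n = b * h" unfolding monadic_def by blast
  have int: "x * y \<in> int_valued" if "x \<in> int_valued" "y \<in> int_valued" for x y :: "'a fract poly"
    using that unfolding int_valued_def by (auto simp: image_iff) (metis to_fract_mult)
  have "fract_poly f ^ (m + n) = (a * b) * (g * h)" using * by (simp add: power_add ac_simps)
  thus "a * b \<in> H" unfolding monadic_def using * int by auto
qed

text \<open>
  An element \<open>monomial \<kappa> k\<close> with exponent \<open>m\<close> of \<open>p\<close> in \<open>\<kappa>\<close> is \<open>p\<close>-integral iff
  \<open>m + weight p k c \<ge> 0\<close> for all \<open>c\<close>. Finitely many of these inequalities suffice; an
  irredundant choice of them is in bijection with the height-one primes containing \<open>p\<close>.
\<close>

definition facets :: "'a \<Rightarrow> 'a set" where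
  "facets p = (SOME D. D \<subseteq> nonroots \<and> finite D \<and> D \<noteq> {} \<and>
     (\<forall>k. \<forall>c\<in>nonroots. \<exists>d\<in>D. weight p k d \<le> weight p k c) \<and>
     (\<forall>c\<in>D. \<exists>k. (\<forall>q. k q > 0) \<and> (\<forall>d\<in>D - {c}. weight p k c < weight p k d)))"

lemma facets:
  assumes "p \<in> fixed_primes"
  shows "facets p \<subseteq> nonroots" "finite (facets p)" "facets p \<noteq> {}"
    "c \<in> nonroots \<Longrightarrow> \<exists>d\<in>facets p. weight p k d \<le> weight p k c"
    "c \<in> facets p \<Longrightarrow> \<exists>k. (\<forall>q. k q > 0) \<and> (\<forall>d\<in>facets p - {c}. weight p k c < weight p k d)"
proof -
  have "\<exists>D. D \<subseteq> nonroots \<and> finite D \<and> D \<noteq> {} \<and>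
     (\<forall>k. \<forall>c\<in>nonroots. \<exists>d\<in>D. weight p k d \<le> weight p k c) \<and>
     (\<forall>c\<in>D. \<exists>k. (\<forall>q. k q > 0) \<and> (\<forall>d\<in>D - {c}. weight p k c < weight p k d))"
    using exists_essential_subset[of B nonroots "\<lambda>c q. multiplicity p (poly q c)"]
      nonroots_nonempty[OF prime_fixed_primes[OF assms]]
    unfolding weight_def by simp
  from someI_ex[OF this] show "facets p \<subseteq> nonroots" "finite (facets p)" "facets p \<noteq> {}"
    "c \<in> nonroots \<Longrightarrow> \<exists>d\<in>facets p. weight p k d \<le> weight p k c"
    "c \<in> facets p \<Longrightarrow> \<exists>k. (\<forall>q. k q > 0) \<and> (\<forall>d\<in>facets p - {c}. weight p k c < weight p k d)"
    unfolding facets_def[symmetric] by blast+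
qed

section \<open>The facet valuations of H\<close>

definition ev :: "'a fract poly \<Rightarrow> 'a \<Rightarrow> 'a" where
  "ev g c = the_inv to_fract (poly g (to_fract c))"

lemma to_fract_ev: "g \<in> int_valued \<Longrightarrow> to_fract (ev g c) = poly g (to_fract c)"
  unfolding ev_def by (rule f_the_inv_into_f) (simp_all add: int_valued_def inj_def)

text \<open>A left index gives the valuation at p of the value at c, a right index the exponent of
  q. By \<open>monomial_unique\<close> the chosen exponent function is determined on
  \<open>B\<close>.\<close>

definition v :: "('a \<times> 'a) + 'a poly \<Rightarrow> 'a fract poly \<Rightarrow> nat" where
  "v i g = (case i of
     Inl (p, c) \<Rightarrow> multiplicity p (ev g c)
   | Inr q \<Rightarrow> (SOME k. \<exists>\<kappa>. \<kappa> \<noteq> 0 \<and> g = monomial \<kappa> k) q)"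

lemma v_Inl:
  assumes "monomial \<kappa> k \<in> int_valued" "\<kappa> \<noteq> 0" "c \<in> nonroots" "prime_elem p"
  shows "int (v (Inl (p, c)) (monomial \<kappa> k)) = fract_val p \<kappa> + int (weight p k c)"
proof -
  have ev: "to_fract (ev (monomial \<kappa> k) c) = poly (monomial \<kappa> k) (to_fract c)" by (rule to_fract_ev) fact
  hence "ev (monomial \<kappa> k) c \<noteq> 0" using fract_val_eval(1)[OF assms(4,3,2), of k] by auto
  hence "int (multiplicity p (ev (monomial \<kappa> k) c)) = fract_val p (poly (monomial \<kappa> k) (to_fract c))"
    unfolding ev[symmetric] using fract_val_to_fract[OF assms(4)] by simp
  thus ?thesis using fract_val_eval(2)[OF assms(4,3,2), of k] by (simp add: v_def)
qed

lemma v_Inr: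
  assumes "\<kappa> \<noteq> 0" "q \<in> B"
  shows "v (Inr q) (monomial \<kappa> k) = k q"
proof -
  have "\<exists>\<kappa>'. \<kappa>' \<noteq> 0 \<and> monomial \<kappa> k = monomial \<kappa>' (SOME k'. \<exists>\<kappa>'. \<kappa>' \<noteq> 0 \<and> monomial \<kappa> k = monomial \<kappa>' k')"
    by (rule someI[where P = "\<lambda>k'. \<exists>\<kappa>'. \<kappa>' \<noteq> 0 \<and> monomial \<kappa> k = monomial \<kappa>' k'" and x = k]) (use assms in blast)
  then obtain \<kappa>' where "\<kappa>' \<noteq> 0"
    "monomial \<kappa> k = monomial \<kappa>' (SOME k'. \<exists>\<kappa>'. \<kappa>' \<noteq> 0 \<and> monomial \<kappa> k = monomial \<kappa>' k')" by blast
  from monomial_unique(2)[OF assms(1) this assms(2)] show ?thesis by (simp add: v_def)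
qed

abbreviation I :: "(('a \<times> 'a) + 'a poly) set" where
  "I \<equiv> (SIGMA p:fixed_primes. facets p) <+> B"

lemma index_cases:
  assumes "i \<in> I"
  obtains (Inl) p c where "i = Inl (p, c)" "p \<in> fixed_primes" "c \<in> facets p" "c \<in> nonroots" "prime_elem p"
    | (Inr) q where "i = Inr q" "q \<in> B"
  using assms that facets(1) prime_fixed_primes by blast

lemma v_monomial:
  assumes "monomial \<kappa> k \<in> H" "\<kappa> \<noteq> 0" "i \<in> I"
  shows "int (v i (monomial \<kappa> k)) = (case i of Inl (p, c) \<Rightarrow> fract_val p \<kappa> + int (weight p k c) | Inr q \<Rightarrow> int (k q))"
  using assms(3) by (cases rule: index_cases) (auto simp: v_Inl v_Inr monadic_int_valued assms)

text \<open>The constant with prescribed valuations at the fixed primes: as \<open>nat\<close>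
  truncates, positive exponents go into the numerator and negative ones into the
  denominator.\<close>

definition scalar :: "('a \<Rightarrow> int) \<Rightarrow> 'a fract" where
  "scalar e = to_fract (\<Prod>p\<in>fixed_primes. p ^ nat (e p)) / to_fract (\<Prod>p\<in>fixed_primes. p ^ nat (- e p))"

lemma scalar_nonzero: "scalar e \<noteq> 0"
  unfolding scalar_def using fixed_primes_nonzero by simp

lemma fract_val_scalar:
  assumes "p \<in> Q"
  shows "fract_val p (scalar e) = (if p \<in> fixed_primes then e p else 0)"
proof -
  have "fract_val p (scalar e) = fract_val p (to_fract (\<Prod>p\<in>fixed_primes. p ^ nat (e p))) - fract_val p (to_fract (\<Prod>p\<in>fixed_primes. p ^ nat (- e p)))"
    unfolding scalar_def using prime_Q[OF assms] by (intro fract_val_divide) (simp_all only: to_fract_eq_0_iff prod_fixed_primes_nonzero not_False_eq_True)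
  also have "\<dots> = (if p \<in> fixed_primes then e p else 0)"
    unfolding fract_val_to_fract[OF prime_Q[OF assms] prod_fixed_primes_nonzero] multiplicity_prod_fixed_primes[OF assms] by simp
  finally show ?thesis .
qed

text \<open>The inequalities at the finitely many facets imply those at all nonroots, since for
  every exponent vector some facet has a weight at most that at c.\<close>

lemma monomial_scalar_in_H:
  assumes "\<And>p c. p \<in> fixed_primes \<Longrightarrow> c \<in> facets p \<Longrightarrow> e p + int (weight p k c) \<ge> 0"
  shows "monomial (scalar e) k \<in> H"
proof (rule monadicI[OF scalar_nonzero])
  fix p c assume pc: "p \<in> fixed_primes" "c \<in> nonroots"
  then obtain d where "d \<in> facets p" "weight p k d \<le> weight p k c" using facets(4) by blast
  thus "fract_val p (scalar e) + int (weight p k c) \<ge> 0"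
    using assms[of p d] pc fract_val_scalar[OF fixed_primes_Q] by force
qed (simp add: fract_val_scalar)

lemma v_scalar:
  assumes "\<And>p c. p \<in> fixed_primes \<Longrightarrow> c \<in> facets p \<Longrightarrow> e p + int (weight p k c) \<ge> 0" "i \<in> I"
  shows "int (v i (monomial (scalar e) k)) = (case i of Inl (p, c) \<Rightarrow> e p + int (weight p k c) | Inr q \<Rightarrow> int (k q))"
  using assms(2) v_monomial[OF monomial_scalar_in_H[OF assms(1)] scalar_nonzero assms(2)]
  by (cases rule: index_cases) (simp_all add: fract_val_scalar fixed_primes_Q)

sublocale facet_valuations H I v
proof
  show "finite I" using facets(2) by (intro finite_Plus finite_SigmaI) auto
next
  fix i a b assume i: "i \<in> I" and ab: "a \<in> H" "b \<in> H"
  obtain \<kappa> k where a: "\<kappa> \<noteq> 0" "a = monomial \<kappa> k" using monadicE[OF ab(1)] by blast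
  obtain \<kappa>' k' where b: "\<kappa>' \<noteq> 0" "b = monomial \<kappa>' k'" using monadicE[OF ab(2)] by blast
  have "int (v i (a * b)) = int (v i a) + int (v i b)"
    using i
  proof (cases rule: index_cases)
    case (Inl p c)
    show ?thesis unfolding a b monomial_mult
      using v_monomial[of "\<kappa> * \<kappa>'" "\<lambda>q. k q + k' q", OF _ _ i] v_monomial[of \<kappa> k, OF _ _ i] v_monomial[of \<kappa>' k', OF _ _ i]
        mult_in[OF ab] ab a b Inl
      by (simp add: monomial_mult fract_val_mult weight_add)
  next
    case (Inr q)
    show ?thesis unfolding a b monomial_mult using v_Inr Inr a(1) b(1) by simp
  qed
  thus "v i (a * b) = v i a + v i b" by linarith
next
  fix a b assume ab: "a \<in> H" "b \<in> H" and le: "\<And>i. i \<in> I \<Longrightarrow> v i a \<le> v i b"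
  obtain \<kappa> k where a: "\<kappa> \<noteq> 0" "a = monomial \<kappa> k" "\<And>p. p \<in> Q - fixed_primes \<Longrightarrow> fract_val p \<kappa> = 0" using monadicE[OF ab(1)] by blast
  obtain \<kappa>' k' where b: "\<kappa>' \<noteq> 0" "b = monomial \<kappa>' k'" "\<And>p. p \<in> Q - fixed_primes \<Longrightarrow> fract_val p \<kappa>' = 0" using monadicE[OF ab(2)] by blast
  define l where "l = (\<lambda>q. k' q - k q)"
  have l: "k q + l q = k' q" if "q \<in> B" for q
  proof -
    have "Inr q \<in> I" using that by blast
    from le[OF this] have "k q \<le> k' q" using that a b by (simp add: v_Inr)
    thus ?thesis by (simp add: l_def)
  qed
  have weight_l: "weight p k c + weight p l c = weight p k' c" for p c
    unfolding weight_add[symmetric] using l by (simp add: weight_def)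
  have "monomial (\<kappa>' / \<kappa>) l \<in> H"
  proof (rule monadicI)
    fix p assume "p \<in> Q - fixed_primes"
    thus "fract_val p (\<kappa>' / \<kappa>) = 0" using a b prime_Q by (simp add: fract_val_divide)
  next
    fix p c assume pc: "p \<in> fixed_primes" "c \<in> nonroots"
    \<comment> \<open>The facet d is chosen for the exponents \<open>l\<close> of the cofactor. The
      comparison of a and b at d then bounds the cofactor at c.\<close>
    obtain d where d: "d \<in> facets p" "weight p l d \<le> weight p l c" using facets(4) pc by blast
    have i: "Inl (p, d) \<in> I" using pc d by blast
    have "fract_val p \<kappa> + int (weight p k d) \<le> fract_val p \<kappa>' + int (weight p k' d)"
      using v_monomial[of \<kappa> k, OF _ a(1) i] v_monomial[of \<kappa>' k', OF _ b(1) i] le[OF i] ab a(2) b(2) by simp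
    thus "fract_val p (\<kappa>' / \<kappa>) + int (weight p l c) \<ge> 0"
      using d(2) weight_l[of p d] a(1) b(1) prime_fixed_primes[OF pc(1)] by (simp add: fract_val_divide)
  qed (use a b in simp)
  moreover have "b = a * monomial (\<kappa>' / \<kappa>) l"
    unfolding a(2) b(2) monomial_mult using a(1) l by (auto intro: monomial_cong)
  ultimately show "\<exists>c\<in>H. b = a * c" by blast
next
  fix i assume i: "i \<in> I"
  \<comment> \<open>Together with \<open>k\<close>, this yields the constant p' for a facet of p',
    and the polynomial q' for the index \<open>Inr q'\<close>.\<close>
  define e :: "'a \<Rightarrow> int" where "e = (\<lambda>p. case i of Inl (p', c) \<Rightarrow> (if p = p' then 1 else 0) | _ \<Rightarrow> 0)"
  define k where "k = (\<lambda>q. case i of Inl _ \<Rightarrow> (0::nat) | Inr q' \<Rightarrow> (if q = q' then 1 else 0))"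
  have nonneg: "e p + int (weight p k c) \<ge> 0" for p c by (auto simp: e_def split: sum.splits prod.splits)
  have "int (v i (monomial (scalar e) k)) = 1"
    using i v_scalar[of e k, OF nonneg i]
    by (cases rule: index_cases) (auto simp: e_def k_def weight_def)
  thus "\<exists>a\<in>H. v i a = 1" using monomial_scalar_in_H[of e k] nonneg by (intro bexI[of _ "monomial (scalar e) k"]) auto
next
  fix i assume i: "i \<in> I"
  thus "\<exists>a\<in>H. v i a = 0 \<and> (\<forall>j\<in>I - {i}. v j a > 0)"
  proof (cases rule: index_cases)
    case (Inl p c)
    obtain k where k: "\<And>q. k q > 0" "\<And>d. d \<in> facets p - {c} \<Longrightarrow> weight p k c < weight p k d"
      using facets(5)[OF Inl(2,3)] by blast
    \<comment> \<open>The exponent at p makes the value at (p, c) exactly 0, and strict minimality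
      of c makes the other facets of p positive. Exponent 1 settles the other primes, and positive
      \<open>k\<close> the right indices.\<close>
    define e where "e = (\<lambda>p'. if p' = p then - int (weight p k c) else 1)"
    have *: "e p' + int (weight p' k d) \<ge> (if p' = p \<and> d = c then 0 else 1)" if "p' \<in> fixed_primes" "d \<in> facets p'" for p' d
      using k(2)[of d] that unfolding e_def by (cases "d = c") auto
    have nonneg: "e p' + int (weight p' k d) \<ge> 0" if "p' \<in> fixed_primes" "d \<in> facets p'" for p' d
      using *[OF that] by (auto split: if_splits)
    have vi: "int (v j (monomial (scalar e) k)) = (case j of Inl (p, c) \<Rightarrow> e p + int (weight p k c) | Inr q \<Rightarrow> int (k q))"
      if "j \<in> I" for j using v_scalar[of e k, OF nonneg that] by simp
    have 1: "v i (monomial (scalar e) k) = 0" using vi[OF i] Inl(1) by (simp add: e_def)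
    have 2: "\<forall>j\<in>I - {i}. v j (monomial (scalar e) k) > 0"
    proof
      fix j assume j: "j \<in> I - {i}"
      have jI: "j \<in> I" using j by blast
      thus "v j (monomial (scalar e) k) > 0"
      proof (cases rule: index_cases)
        case (Inl p' d)
        hence "\<not> (p' = p \<and> d = c)" using j \<open>i = Inl (p, c)\<close> by blast
        hence "e p' + int (weight p' k d) \<ge> 1" using *[OF Inl(2,3)] by (simp split: if_splits)
        thus ?thesis using vi[OF jI] Inl(1) by simp
      next
        case (Inr q)
        thus ?thesis using vi[OF jI] k(1)[of q] by simp
      qed
    qed
    have 3: "monomial (scalar e) k \<in> H" by (rule monomial_scalar_in_H) (rule nonneg)
    show ?thesis by (intro bexI[of _ "monomial (scalar e) k"] conjI 1 2 3)
  next
    case (Inr q)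
    \<comment> \<open>The product of all fixed primes is positive on every left facet, so only the
      exponent of q has to vanish.\<close>
    define e where "e = (\<lambda>p::'a. 1::int)"
    define k where "k = (\<lambda>q'. if q' = q then 0 else 1::nat)"
    have nonneg: "e p' + int (weight p' k d) \<ge> 0" for p' d by (simp add: e_def)
    have vi: "int (v j (monomial (scalar e) k)) = (case j of Inl (p, c) \<Rightarrow> e p + int (weight p k c) | Inr q \<Rightarrow> int (k q))"
      if "j \<in> I" for j using v_scalar[of e k, OF nonneg that] by simp
    have 1: "v i (monomial (scalar e) k) = 0" using vi[OF i] Inr(1) by (simp add: k_def)
    have 2: "\<forall>j\<in>I - {i}. v j (monomial (scalar e) k) > 0"
    proof
      fix j assume j: "j \<in> I - {i}"
      have jI: "j \<in> I" using j by blast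
      thus "v j (monomial (scalar e) k) > 0"
      proof (cases rule: index_cases)
        case (Inl p' d)
        thus ?thesis using vi[OF jI] by (simp add: e_def)
      next
        case (Inr q')
        hence "q' \<noteq> q" using j \<open>i = Inr q\<close> by blast
        thus ?thesis using vi[OF jI] Inr by (simp add: k_def)
      qed
    qed
    have 3: "monomial (scalar e) k \<in> H" by (rule monomial_scalar_in_H) (rule nonneg)
    show ?thesis by (intro bexI[of _ "monomial (scalar e) k"] conjI 1 2 3)
  qed
qed

end

lemma finite_int_power_group_iff: "finite (carrier (int_power_group n)) \<longleftrightarrow> n = 0"
proof -
  have carrier: "carrier (int_power_group n) = (\<Pi>\<^sub>E i\<in>{..<n}. UNIV)"
    by (simp add: int_power_group_def product_group_def integer_group_def)
  have "infinite (\<Pi>\<^sub>E i\<in>{..<n}. UNIV :: int set)" if "n > 0"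
  proof
    assume fin: "finite (\<Pi>\<^sub>E i\<in>{..<n}. UNIV :: int set)"
    have "(\<lambda>f. f 0) ` (\<Pi>\<^sub>E i\<in>{..<n}. UNIV :: int set) = UNIV"
    proof (intro Set.set_eqI iffI UNIV_I)
      fix z :: int
      show "z \<in> (\<lambda>f. f 0) ` (\<Pi>\<^sub>E i\<in>{..<n}. UNIV)"
        by (rule image_eqI[of _ _ "\<lambda>i\<in>{..<n}. z"]) (use that in auto)
    qed
    thus False using fin infinite_UNIV_int finite_imageI by metis
  qed
  thus ?thesis unfolding carrier by (cases "n = 0") auto
qed

context factored_polynomial
begin

subsection \<open>Constants\<close>

abbreviation const :: "'a \<Rightarrow> 'a fract poly" where "const a \<equiv> [:to_fract a:]"

lemma const_monomial: "const a = monomial (to_fract a) (\<lambda>_. 0)"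
  by (simp add: monomial_def)

lemma ev_const [simp]: "ev (const a) c = a"
  unfolding ev_def by (simp add: the_inv_f_f inj_def)

lemma v_const_Inl [simp]: "v (Inl (p, c)) (const a) = multiplicity p a"
  by (simp add: v_def)

lemma v_const_Inr: "a \<noteq> 0 \<Longrightarrow> q \<in> B \<Longrightarrow> v (Inr q) (const a) = 0"
  unfolding const_monomial by (rule v_Inr) auto

lemma const_fixed_primes_in_H: "p \<in> fixed_primes \<Longrightarrow> const p \<in> H"
  unfolding const_monomial
  by (rule monadicI) (auto simp: fixed_primes_nonzero fract_val_to_fract prime_Q prime_fixed_primes multiplicity_Q fixed_primes_Q)

lemma const_nonzero: "const a \<in> H \<Longrightarrow> a \<noteq> 0"
  using nonzero by fastforce

lemma const_polysI: "x \<in> H \<Longrightarrow> (\<And>q. q \<in> B \<Longrightarrow> v (Inr q) x = 0) \<Longrightarrow> x \<in> const_polys"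
proof -
  assume x: "x \<in> H" and 0: "\<And>q. q \<in> B \<Longrightarrow> v (Inr q) x = 0"
  obtain \<kappa> k where \<kappa>: "\<kappa> \<noteq> 0" "x = monomial \<kappa> k" using monadicE[OF x] by blast
  have "x = monomial \<kappa> (\<lambda>_. 0)" unfolding \<kappa>(2) by (rule monomial_cong) (use 0 \<kappa> v_Inr in auto)
  hence x': "x = [:\<kappa>:]" by (simp add: monomial_def)
  have "poly x (to_fract 0) \<in> range to_fract" using monadic_int_valued[OF x] unfolding int_valued_def by blast
  thus "x \<in> const_polys" using x' unfolding const_polys_def by auto
qed

lemma const_unit: "const a \<in> H \<Longrightarrow> a dvd 1 \<Longrightarrow> const a \<in> Units (submon H)"
  unfolding unit_iff
proof (intro conjI ballI)
  fix i assume "const a \<in> H" "a dvd 1" "i \<in> I"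
  from this(3) show "v i (const a) = 0"
    by (cases rule: index_cases)
       (use \<open>a dvd 1\<close> \<open>const a \<in> H\<close> in \<open>auto simp: v_const_Inr const_nonzero multiplicity_unit_right\<close>)
qed

text \<open>A nonzero constant has exponent 0 at every q, so primes with a right index contain none;
  a prime belonging to (p, c) contains the constant p.\<close>

lemma height_one_primes_const:
  "{P \<in> height_one_primes H. P \<inter> const_polys \<noteq> {}} = prime_of ` Inl ` (SIGMA p:fixed_primes. facets p)"
proof (intro Set.set_eqI iffI)
  fix P assume "P \<in> {P \<in> height_one_primes H. P \<inter> const_polys \<noteq> {}}"
  then obtain i x where i: "i \<in> I" "P = prime_of i" "x \<in> prime_of i" "x \<in> const_polys"
    unfolding height_one_primes_eq by blast
  then obtain a where a: "const a \<in> H" "v i (const a) > 0"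
    unfolding const_polys_def prime_of_def by auto
  from i(1) show "P \<in> prime_of ` Inl ` (SIGMA p:fixed_primes. facets p)"
    by (cases rule: index_cases) (use i a v_const_Inr const_nonzero in auto)
next
  fix P assume "P \<in> prime_of ` Inl ` (SIGMA p:fixed_primes. facets p)"
  then obtain p c where pc: "p \<in> fixed_primes" "c \<in> facets p" "P = prime_of (Inl (p, c))" by blast
  have "const p \<in> P" using pc const_fixed_primes_in_H prime_fixed_primes by (simp add: prime_of_def)
  moreover have "const p \<in> const_polys" by (simp add: const_polys_def)
  moreover have "P \<in> height_one_primes H" unfolding height_one_primes_eq using pc by blast
  ultimately show "P \<in> {P \<in> height_one_primes H. P \<inter> const_polys \<noteq> {}}" by blast
qed

lemma card_height_one_primes_const:
  "card {P \<in> height_one_primes H. P \<inter> const_polys \<noteq> {}} = (\<Sum>p\<in>fixed_primes. card (facets p))"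
proof -
  have "inj_on prime_of (Inl ` (SIGMA p:fixed_primes. facets p))"
    by (rule inj_on_subset[OF inj_prime_of]) auto
  thus ?thesis unfolding height_one_primes_const using facets(2)
    by (simp add: card_image card_SigmaI)
qed

text \<open>Exponents add, so every factor of the constant p in H is itself constant; irreducibility
  of p in R then makes one of the two factors a unit.\<close>

lemma irreducible_const:
  assumes p: "p \<in> fixed_primes"
  shows "const p \<in> atoms H"
proof -
  obtain c where "c \<in> facets p" using facets(3)[OF p] by blast
  hence i: "Inl (p, c) \<in> I" using p by blast
  have "const p \<notin> Units (submon H)"
  proof
    assume "const p \<in> Units (submon H)"
    hence "\<forall>i\<in>I. v i (const p) = 0" unfolding unit_iff ..
    from bspec[OF this i] show False using prime_fixed_primes[OF p] by simp
  qed
  moreover have "b \<in> Units (submon H)"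
    if b: "b \<in> H" "properfactor (submon H) b (const p)" for b
  proof -
    obtain h where h: "h \<in> H" "const p = b * h"
      and not: "\<not> const p divides\<^bsub>submon H\<^esub> b"
      using b(2) unfolding properfactor_def factor_def submon_simps by blast
    have "v (Inr q) b = 0 \<and> v (Inr q) h = 0" if "q \<in> B" for q
    proof -
      have "Inr q \<in> I" using that by blast
      hence "v (Inr q) b + v (Inr q) h = v (Inr q) (const p)" using b h v_mult by simp
      thus ?thesis using v_const_Inr[OF fixed_primes_nonzero[OF p] that] by simp
    qed
    hence "b \<in> const_polys" "h \<in> const_polys" using const_polysI b(1) h(1) by blast+
    then obtain a a' where a: "b = const a" "h = const a'" unfolding const_polys_def by blast
    hence "const p = const (a * a')" using h(2) by simp
    hence "p = a * a'" by (simp only: pCons_eq_iff to_fract_eq_iff)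
    then consider "a dvd 1" | "a' dvd 1"
      using prime_elem_imp_irreducible[OF prime_fixed_primes[OF p]] irreducibleD by blast
    thus ?thesis
    proof cases
      case 1
      thus ?thesis using const_unit b(1) a by simp
    next
      case 2
      hence "h \<in> Units (submon H)" using const_unit h(1) a by simp
      then obtain w where w: "w \<in> H" "w * h = 1" unfolding Units_def by auto
      hence "b = const p * w" unfolding h(2) by (simp add: mult.assoc mult.commute[of h w])
      thus ?thesis using not w(1) unfolding factor_def submon_simps by blast
    qed
  qed
  ultimately show ?thesis unfolding atoms_def Divisibility.irreducible_def
    using const_fixed_primes_in_H[OF p] by (simp only: submon_simps mem_Collect_eq) blast
qed

lemma associated_principal_eq:
  assumes "x \<in> H" "y \<in> H" "z \<in> H" "w \<in> H" "y = x * z" "x = y * w"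
  shows "y *o H = x *o H"
proof (intro Set.set_eqI iffI)
  fix u assume "u \<in> y *o H"
  then obtain h where h: "h \<in> H" "u = y * h" unfolding elt_set_times_def by blast
  have "u = x * (z * h)" unfolding h(2) by (subst assms(5)) (rule mult.assoc)
  thus "u \<in> x *o H" using mult_in[OF assms(3) h(1)] unfolding elt_set_times_def by blast
next
  fix u assume "u \<in> x *o H"
  then obtain h where h: "h \<in> H" "u = x * h" unfolding elt_set_times_def by blast
  have "u = y * (w * h)" unfolding h(2) by (subst assms(6)) (rule mult.assoc)
  thus "u \<in> y *o H" using mult_in[OF assms(4) h(1)] unfolding elt_set_times_def by blast
qed

text \<open>A constant nonunit of H is positive at some (p, c). The value of a constant does not
  depend on c, so it dominates the constant p on all facets and is divisible by it in H; an atom is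
  then associated to it.\<close>

lemma atoms_const:
  "{u *o H | u. u \<in> atoms H \<inter> const_polys} = (\<lambda>p. const p *o H) ` fixed_primes"
proof (intro Set.set_eqI iffI)
  fix S assume "S \<in> {u *o H | u. u \<in> atoms H \<inter> const_polys}"
  then obtain a where a: "const a \<in> atoms H" "S = const a *o H" unfolding const_polys_def by blast
  hence aH: "const a \<in> H" and irr: "Divisibility.irreducible (submon H) (const a)" unfolding atoms_def by auto
  have "const a \<notin> Units (submon H)" using irr unfolding Divisibility.irreducible_def by blast
  then obtain i where i: "i \<in> I" "v i (const a) > 0" unfolding unit_iff using aH by blast
  from i(1) obtain p c where p: "p \<in> fixed_primes" "c \<in> facets p" "i = Inl (p, c)"
    by (cases rule: index_cases) (use i v_const_Inr const_nonzero[OF aH] in auto)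
  have pH: "const p \<in> H" by (rule const_fixed_primes_in_H) fact
  have "v j (const p) \<le> v j (const a)" if "j \<in> I" for j
    using that by (cases rule: index_cases)
      (use i p fixed_primes_nonzero in \<open>auto simp: v_const_Inr multiplicity_Q fixed_primes_Q\<close>)
  then obtain h where h: "h \<in> H" "const a = const p * h" using v_dvd[OF pH aH] by blast
  have "const p \<notin> Units (submon H)"
    using irreducible_const[OF p(1)] unfolding atoms_def Divisibility.irreducible_def by blast
  hence "\<not> properfactor (submon H) (const p) (const a)"
    using irr pH unfolding Divisibility.irreducible_def by auto
  moreover have "const p divides\<^bsub>submon H\<^esub> const a"
    unfolding factor_def submon_simps using h by blast
  ultimately have "const a divides\<^bsub>submon H\<^esub> const p" unfolding properfactor_def by blast
  then obtain w where "w \<in> H" "const p = const a * w" unfolding factor_def submon_simps by blast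
  hence "S = const p *o H" using associated_principal_eq[OF pH aH h(1) _ h(2)] a(2) by blast
  thus "S \<in> (\<lambda>p. const p *o H) ` fixed_primes" using p(1) by blast
next
  fix S assume "S \<in> (\<lambda>p. const p *o H) ` fixed_primes"
  then obtain p where p: "p \<in> fixed_primes" "S = const p *o H" by blast
  moreover have "const p \<in> const_polys" by (simp add: const_polys_def)
  ultimately show "S \<in> {u *o H | u. u \<in> atoms H \<inter> const_polys}" using irreducible_const by blast
qed

lemma card_atoms_const: "card {u *o H | u. u \<in> atoms H \<inter> const_polys} = card fixed_primes"
  unfolding atoms_const
proof (rule card_image, rule inj_onI)
  fix p q assume pq: "p \<in> fixed_primes" "q \<in> fixed_primes" "const p *o H = const q *o H"
  have "const p \<in> const p *o H" unfolding elt_set_times_def using one_in by force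
  hence "const p \<in> const q *o H" by (simp only: pq(3))
  then obtain h where h: "h \<in> H" "const p = const q * h"
    unfolding elt_set_times_def mem_Collect_eq by (elim bexE)
  obtain c where c: "c \<in> facets q" using facets(3) pq by blast
  hence "Inl (q, c) \<in> I" using pq by blast
  hence "v (Inl (q, c)) (const p) = v (Inl (q, c)) (const q) + v (Inl (q, c)) h"
    unfolding h(2) using v_mult const_fixed_primes_in_H[OF pq(2)] h(1) by blast
  thus "p = q" using multiplicity_Q[OF fixed_primes_Q fixed_primes_Q, OF pq(2,1)] prime_fixed_primes[OF pq(2)] by (simp split: if_splits)
qed

subsection \<open>The class group\<close>

text \<open>The analogue of \<open>weight\<close> for integer exponents, read off from the
  coordinates \<open>Inr q\<close>.\<close>

definition lin :: "(('a \<times> 'a) + 'a poly \<Rightarrow> int) \<Rightarrow> 'a \<Rightarrow> 'a \<Rightarrow> int" where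
  "lin a p c = (\<Sum>q\<in>B. a (Inr q) * int (multiplicity p (poly q c)))"

lemma weight_eq: "int (weight p k c) = (\<Sum>q\<in>B. int (k q) * int (multiplicity p (poly q c)))"
  by (simp add: weight_def)

text \<open>The exponents of the factors may be any integers in the quotient group and determine the
  summand \<open>lin\<close>. What remains at (p, c) is the valuation of the constant, which may be
  any integer but is the same for all c.\<close>

lemma principal_vector_iff:
  "(\<exists>x\<in>L. \<forall>i\<in>I. a i = \<phi> i x) \<longleftrightarrow>
   (\<exists>m. \<forall>p\<in>fixed_primes. \<forall>c\<in>facets p. a (Inl (p, c)) = m p + lin a p c)"
proof
  assume "\<exists>x\<in>L. \<forall>i\<in>I. a i = \<phi> i x"
  then obtain x where x: "x \<in> L" "\<And>i. i \<in> I \<Longrightarrow> a i = \<phi> i x" by blast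
  obtain g h where gh: "g \<in> H" "h \<in> H" "x = to_fract g / to_fract h" using x(1) by (elim quot_groupE)
  have a: "a i = int (v i g) - int (v i h)" if "i \<in> I" for i
    using x(2)[OF that] gh that by (simp add: \<phi>_divide)
  obtain \<kappa> k where g: "\<kappa> \<noteq> 0" "g = monomial \<kappa> k" using monadicE[OF gh(1)] by blast
  obtain \<kappa>' k' where h: "\<kappa>' \<noteq> 0" "h = monomial \<kappa>' k'" using monadicE[OF gh(2)] by blast
  have "a (Inl (p, c)) = (fract_val p \<kappa> - fract_val p \<kappa>') + lin a p c" if pc: "p \<in> fixed_primes" "c \<in> facets p" for p c
  proof -
    have i: "Inl (p, c) \<in> I" using pc by blast
    have "lin a p c = (\<Sum>q\<in>B. (int (k q) - int (k' q)) * int (multiplicity p (poly q c)))"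
      unfolding lin_def
    proof (rule sum.cong)
      fix q assume q: "q \<in> B"
      hence "a (Inr q) = int (k q) - int (k' q)" using a[of "Inr q"] g h v_Inr by auto
      thus "a (Inr q) * int (multiplicity p (poly q c)) = (int (k q) - int (k' q)) * int (multiplicity p (poly q c))"
        by simp
    qed simp
    also have "\<dots> = int (weight p k c) - int (weight p k' c)"
      unfolding weight_eq by (simp add: sum_subtractf left_diff_distrib)
    finally have lin: "lin a p c = int (weight p k c) - int (weight p k' c)" .
    have "int (v (Inl (p, c)) g) = fract_val p \<kappa> + int (weight p k c)"
      using v_monomial[of \<kappa> k, OF _ g(1) i] gh(1) unfolding g(2) by simp
    moreover have "int (v (Inl (p, c)) h) = fract_val p \<kappa>' + int (weight p k' c)"
      using v_monomial[of \<kappa>' k', OF _ h(1) i] gh(2) unfolding h(2) by simp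
    ultimately show ?thesis using a[OF i] lin by simp
  qed
  thus "\<exists>m. \<forall>p\<in>fixed_primes. \<forall>c\<in>facets p. a (Inl (p, c)) = m p + lin a p c"
    by (intro exI[of _ "\<lambda>p. fract_val p \<kappa> - fract_val p \<kappa>'"]) blast
next
  assume "\<exists>m. \<forall>p\<in>fixed_primes. \<forall>c\<in>facets p. a (Inl (p, c)) = m p + lin a p c"
  then obtain m where m: "\<And>p c. p \<in> fixed_primes \<Longrightarrow> c \<in> facets p \<Longrightarrow> a (Inl (p, c)) = m p + lin a p c" by blast
  \<comment> \<open>For s = 1 and s = -1 these are the positive and the negative part of the
    required data; their quotient realizes \<open>a\<close>.\<close>
  define g where "g = (\<lambda>s. monomial (scalar (\<lambda>p. max 0 (s * m p))) (\<lambda>q. nat (s * a (Inr q))))"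
  have gH: "g s \<in> H" for s unfolding g_def by (rule monomial_scalar_in_H) simp
  have vg: "int (v i (g s)) = (case i of
      Inl (p, c) \<Rightarrow> max 0 (s * m p) + (\<Sum>q\<in>B. max 0 (s * a (Inr q)) * int (multiplicity p (poly q c)))
    | Inr q \<Rightarrow> max 0 (s * a (Inr q)))" if "i \<in> I" for i s
  proof -
    have "int (v i (g s)) = (case i of
      Inl (p, c) \<Rightarrow> max 0 (s * m p) + int (weight p (\<lambda>q. nat (s * a (Inr q))) c)
    | Inr q \<Rightarrow> int (nat (s * a (Inr q))))"
      unfolding g_def by (rule v_scalar[OF _ that]) simp
    thus ?thesis by (auto simp: weight_eq max_def split: sum.splits intro!: sum.cong)
  qed
  have "a i = \<phi> i (to_fract (g 1) / to_fract (g (- 1)))" if i: "i \<in> I" for i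
  proof -
    have "\<phi> i (to_fract (g 1) / to_fract (g (- 1))) = int (v i (g 1)) - int (v i (g (- 1)))"
      using i gH by (simp add: \<phi>_divide)
    also have "\<dots> = a i"
      using i
    proof (cases rule: index_cases)
      case (Inl p c)
      have max_diff: "max 0 (1 * z) - max 0 (- 1 * z) = z" for z :: int by simp
      have "int (v i (g 1)) - int (v i (g (- 1))) =
          (max 0 (1 * m p) - max 0 (- 1 * m p)) +
          (\<Sum>q\<in>B. (max 0 (1 * a (Inr q)) - max 0 (- 1 * a (Inr q))) * int (multiplicity p (poly q c)))"
        using vg[OF i, of 1] vg[OF i, of "- 1"] Inl(1) by (simp add: sum_subtractf left_diff_distrib)
      also have "\<dots> = m p + lin a p c" unfolding max_diff lin_def ..
      finally show ?thesis using m Inl by simp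
    next
      case (Inr q)
      thus ?thesis using vg[OF i, of 1] vg[OF i, of "- 1"] by simp
    qed
    finally show ?thesis by simp
  qed
  thus "\<exists>x\<in>L. \<forall>i\<in>I. a i = \<phi> i x" using gH by (intro bexI[of _ "to_fract (g 1) / to_fract (g (- 1))"]) auto
qed

section \<open>The rank and the free class group\<close>

definition base :: "'a \<Rightarrow> 'a" where "base p = (SOME c. c \<in> facets p)"

lemma base: "p \<in> fixed_primes \<Longrightarrow> base p \<in> facets p"
  unfolding base_def using someI_ex[of "\<lambda>c. c \<in> facets p"] facets(3)[of p] by blast

definition rank :: nat where "rank = (\<Sum>p\<in>fixed_primes. card (facets p) - 1)"

lemma rank_eq: "int rank = int (\<Sum>p\<in>fixed_primes. card (facets p)) - int (card fixed_primes)"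
proof -
  have "card (facets p) \<ge> 1" if "p \<in> fixed_primes" for p
    using facets(2,3)[OF that] by (simp add: Suc_leI card_gt_0_iff)
  hence "(\<Sum>p\<in>fixed_primes. int (card (facets p) - 1)) = (\<Sum>p\<in>fixed_primes. int (card (facets p)) - 1)"
    by (intro sum.cong) auto
  thus ?thesis unfolding rank_def by (simp add: sum_subtractf)
qed

lemma rank_0_iff: "rank = 0 \<longleftrightarrow> (\<forall>p\<in>fixed_primes. facets p = {base p})"
proof -
  have "card (facets p) - 1 = 0 \<longleftrightarrow> facets p = {base p}" if p: "p \<in> fixed_primes" for p
  proof
    assume "card (facets p) - 1 = 0"
    hence "card (facets p) = 1" using facets(2,3)[OF p] by (simp add: card_gt_0_iff Suc_leI le_antisym)
    then obtain c where "facets p = {c}" by (elim card_1_singletonE)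
    thus "facets p = {base p}" using base[OF p] by auto
  next
    assume "facets p = {base p}"
    hence "card (facets p) = card {base p}" by (rule arg_cong)
    thus "card (facets p) - 1 = 0" by simp
  qed
  thus ?thesis unfolding rank_def by simp
qed

text \<open>Subtracting from each coordinate at (p, c) the one at the reference facet of p removes
  the free parameter \<open>m p\<close>. One integer is left for each facet other than the reference
  facets.\<close>

lemma class_group_iso_int_power: "class_group H \<cong> int_power_group rank"
proof -
  define J where "J = (SIGMA p:fixed_primes. facets p - {base p})"
  have J_fin: "finite J" unfolding J_def using facets(2) by (intro finite_SigmaI) auto
  have "card J = (\<Sum>p\<in>fixed_primes. card (facets p - {base p}))"
    unfolding J_def using facets(2) by (simp add: card_SigmaI)
  also have "\<dots> = rank" unfolding rank_def using base by (intro sum.cong) auto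
  finally have "card J = rank" .
  then obtain e where e: "bij_betw e {..<rank} J"
    using ex_bij_betw_nat_finite[OF J_fin] by (auto simp: atLeast0LessThan)
  \<comment> \<open>The part of a left coordinate not explained by the exponents.\<close>
  define dev where "dev = (\<lambda>a (p, c). a (Inl (p, c)) - lin a p c)"
  define \<psi> where "\<psi> = (\<lambda>a. \<lambda>n\<in>{..<rank}. dev a (e n) - dev a (fst (e n), base (fst (e n))))"
  have carrier_I: "carrier Z\<^sub>I = (\<Pi>\<^sub>E i\<in>I. UNIV)"
    by (simp add: product_group_def integer_group_def)
  have carrier_r: "carrier (int_power_group rank) = (\<Pi>\<^sub>E i\<in>{..<rank}. UNIV)"
    by (simp add: int_power_group_def product_group_def integer_group_def)
  have dev_add: "dev (\<lambda>i\<in>I. a i + b i) (p, c) = dev a (p, c) + dev b (p, c)"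
    if "p \<in> fixed_primes" "c \<in> facets p" for a b p c
  proof -
    have "lin (\<lambda>i\<in>I. a i + b i) p c = lin a p c + lin b p c"
      unfolding lin_def sum.distrib[symmetric] by (rule sum.cong) (auto simp: algebra_simps)
    thus ?thesis using that by (auto simp: dev_def)
  qed
  have e_in: "fst (e n) \<in> fixed_primes" "snd (e n) \<in> facets (fst (e n))" if "n < rank" for n
  proof -
    have "e n \<in> J" using bij_betwE[OF e] that by blast
    thus "fst (e n) \<in> fixed_primes" "snd (e n) \<in> facets (fst (e n))" unfolding J_def by auto
  qed
  have hom: "\<psi> \<in> hom Z\<^sub>I (int_power_group rank)"
  proof (rule homI)
    fix a b
    have "\<psi> (\<lambda>i\<in>I. a i + b i) = (\<lambda>n\<in>{..<rank}. \<psi> a n + \<psi> b n)"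
    proof
      fix n
      show "\<psi> (\<lambda>i\<in>I. a i + b i) n = (\<lambda>n\<in>{..<rank}. \<psi> a n + \<psi> b n) n"
      proof (cases "n < rank")
        case True
        have "dev (\<lambda>i\<in>I. a i + b i) (e n) = dev a (e n) + dev b (e n)"
          using dev_add[OF e_in[OF True]] by simp
        thus ?thesis using dev_add[OF e_in(1)[OF True] base[OF e_in(1)[OF True]]] True
          by (simp add: \<psi>_def)
      qed (simp add: \<psi>_def)
    qed
    thus "\<psi> (a \<otimes>\<^bsub>Z\<^sub>I\<^esub> b) = \<psi> a \<otimes>\<^bsub>int_power_group rank\<^esub> \<psi> b"
      by (simp add: int_power_group_def product_group_def integer_group_def)
  qed (simp add: carrier_r \<psi>_def)
  have onto: "\<psi> ` carrier Z\<^sub>I = carrier (int_power_group rank)"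
  proof (intro Set.set_eqI iffI)
    fix z assume z: "z \<in> carrier (int_power_group rank)"
    \<comment> \<open>A preimage with zero exponents, so that \<open>lin\<close> vanishes, and with
      zero at the reference facets, so that the entries of z can be copied.\<close>
    define a where "a = (\<lambda>i\<in>I. case i of
        Inl (p, c) \<Rightarrow> if c = base p then 0 else z (inv_into {..<rank} e (p, c)) | Inr _ \<Rightarrow> (0::int))"
    have "lin a p c = 0" for p c unfolding lin_def a_def by (simp add: InrI)
    hence dev_a: "dev a (p, c) = (if c = base p then 0 else z (inv_into {..<rank} e (p, c)))"
      if "p \<in> fixed_primes" "c \<in> facets p" for p c using that by (auto simp: dev_def a_def)
    have "\<psi> a = z"
    proof
      fix n
      show "\<psi> a n = z n"
      proof (cases "n < rank")
        case True
        have "e n \<in> J" using bij_betwE[OF e] True by blast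
        hence "snd (e n) \<noteq> base (fst (e n))" unfolding J_def by auto
        hence "dev a (e n) = z n"
          using dev_a[OF e_in[OF True]] True e by (simp add: bij_betw_inv_into_left)
        thus ?thesis using dev_a[OF e_in(1)[OF True] base[OF e_in(1)[OF True]]] True by (simp add: \<psi>_def)
      qed (use z in \<open>auto simp: \<psi>_def carrier_r PiE_def extensional_def\<close>)
    qed
    moreover have "a \<in> carrier Z\<^sub>I" unfolding carrier_I a_def by simp
    ultimately show "z \<in> \<psi> ` carrier Z\<^sub>I" by blast
  qed (use hom in \<open>auto simp: hom_def\<close>)
  have ker: "\<psi> a = \<one>\<^bsub>int_power_group rank\<^esub> \<longleftrightarrow> (\<exists>x\<in>L. \<forall>i\<in>I. a i = \<phi> i x)" for a
  proof -
    have "\<psi> a = \<one>\<^bsub>int_power_group rank\<^esub> \<longleftrightarrow> (\<forall>n<rank. dev a (e n) = dev a (fst (e n), base (fst (e n))))"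
      unfolding \<psi>_def by (auto simp: int_power_group_def product_group_def integer_group_def fun_eq_iff)
    also have "\<dots> \<longleftrightarrow> (\<forall>j\<in>e ` {..<rank}. dev a j = dev a (fst j, base (fst j)))" by auto
    also have "\<dots> \<longleftrightarrow> (\<forall>p\<in>fixed_primes. \<forall>c\<in>facets p. dev a (p, c) = dev a (p, base p))"
      unfolding bij_betw_imp_surj_on[OF e] J_def by auto
    also have "\<dots> \<longleftrightarrow> (\<exists>m. \<forall>p\<in>fixed_primes. \<forall>c\<in>facets p. dev a (p, c) = m p)"
      (is "?l \<longleftrightarrow> ?r")
    proof
      assume ?r
      then obtain m where "\<forall>p\<in>fixed_primes. \<forall>c\<in>facets p. dev a (p, c) = m p" by blast
      thus ?l using base by simp
    next
      assume ?l
      thus ?r by (intro exI[of _ "\<lambda>p. dev a (p, base p)"])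
    qed
    also have "\<dots> \<longleftrightarrow> (\<exists>m. \<forall>p\<in>fixed_primes. \<forall>c\<in>facets p. a (Inl (p, c)) = m p + lin a p c)"
      by (simp add: dev_def algebra_simps)
    finally show ?thesis unfolding principal_vector_iff .
  qed
  have "group (int_power_group rank)" unfolding int_power_group_def by (simp add: group_integer_group)
  from class_group_iso[OF this hom onto ker] show ?thesis .
qed

lemma finite_class_group_iff: "finite (carrier (class_group H)) \<longleftrightarrow> rank = 0"
proof -
  obtain h where "bij_betw h (carrier (class_group H)) (carrier (int_power_group rank))"
    using class_group_iso_int_power unfolding is_iso_def iso_def by blast
  thus ?thesis using bij_betw_finite finite_int_power_group_iff by blast
qed

lemma unit_vec_const:
  assumes p: "p \<in> fixed_primes" "facets p = {c}" and j: "j \<in> I"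
  shows "int (v j (const p)) = unit_vec (Inl (p, c)) j"
  using j by (cases rule: index_cases)
    (use p fixed_primes_nonzero in \<open>auto simp: v_const_Inr multiplicity_Q fixed_primes_Q\<close>)

text \<open>An element whose value vector is the unit vector of (p, c) has zero exponents and is
  constant, so it takes equal values on all facets of p; a second facet is thus impossible. If each
  p has one facet, the constants p and suitable multiples of the factors q realize all unit
  vectors.\<close>

lemma factorial_iff_rank: "factorial H \<longleftrightarrow> rank = 0"
  unfolding factorial_iff
proof
  assume *: "\<forall>i\<in>I. \<exists>x\<in>H. \<forall>j\<in>I. int (v j x) = unit_vec i j"
  have "c = base p" if pc: "p \<in> fixed_primes" "c \<in> facets p" for p c
  proof (rule ccontr)
    assume ne: "c \<noteq> base p"
    have i: "Inl (p, c) \<in> I" "Inl (p, base p) \<in> I" using pc base by blast+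
    obtain x where x: "x \<in> H" "\<forall>j\<in>I. int (v j x) = unit_vec (Inl (p, c)) j"
      using bspec[OF * i(1)] by (elim bexE)
    have "v (Inr q) x = 0" if "q \<in> B" for q
    proof -
      have "Inr q \<in> I" using that by blast
      from bspec[OF x(2) this] show ?thesis by simp
    qed
    hence "x \<in> const_polys" using const_polysI x(1) by blast
    then obtain b where "x = const b" unfolding const_polys_def by blast
    thus False using bspec[OF x(2) i(1)] bspec[OF x(2) i(2)] ne by simp
  qed
  thus "rank = 0" unfolding rank_0_iff using base by blast
next
  assume "rank = 0"
  hence single: "\<And>p. p \<in> fixed_primes \<Longrightarrow> facets p = {base p}" unfolding rank_0_iff by blast
  show "\<forall>i\<in>I. \<exists>x\<in>H. \<forall>j\<in>I. int (v j x) = unit_vec i j"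
  proof
    fix i assume "i \<in> I"
    thus "\<exists>x\<in>H. \<forall>j\<in>I. int (v j x) = unit_vec i j"
    proof (cases rule: index_cases)
      case (Inl p c)
      hence "facets p = {c}" using single[of p] by auto
      thus ?thesis using unit_vec_const Inl const_fixed_primes_in_H by blast
    next
      case (Inr q)
      define k where "k = (\<lambda>q'. if q' = q then 1 else 0 :: nat)"
      \<comment> \<open>Divides q by the powers of the fixed primes that divide its values; the
        single facet of each p then has value 0.\<close>
      define e where "e = (\<lambda>p. - int (weight p k (base p)))"
      have e: "e p + int (weight p k c) = 0" if "p \<in> fixed_primes" "c \<in> facets p" for p c
        using single[OF that(1)] that(2) by (simp add: e_def)
      have "int (v j (monomial (scalar e) k)) = unit_vec i j" if "j \<in> I" for j
      proof -
        have "int (v j (monomial (scalar e) k)) =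
            (case j of Inl (p, c) \<Rightarrow> e p + int (weight p k c) | Inr q \<Rightarrow> int (k q))"
          by (rule v_scalar[OF _ that]) (simp add: e)
        moreover have "int (k q') = (if q' = q then 1 else 0)" for q' by (simp add: k_def)
        ultimately show ?thesis by (cases rule: index_cases[OF that]) (auto simp: e Inr(1))
      qed
      moreover have "monomial (scalar e) k \<in> H" by (rule monomial_scalar_in_H) (simp add: e)
      ultimately show ?thesis by blast
    qed
  qed
qed

text \<open>The difference of the two unit vectors has no right coordinates, so being principal it
  must be constant on the facets of p. For p = p' this contradicts the values 1 and -1. For
  different primes it leaves c as the only facet of p, and then the constant p generates P.\<close>

lemma inj_ideal_class_nonprincipal:
  "inj_on (ideal_class H)
     {P \<in> height_one_primes H. P \<inter> const_polys \<noteq> {} \<and> \<not> principal_ideal H P}"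
proof (rule inj_onI)
  fix P P' assume P: "P \<in> {P \<in> height_one_primes H. P \<inter> const_polys \<noteq> {} \<and> \<not> principal_ideal H P}"
    and P': "P' \<in> {P \<in> height_one_primes H. P \<inter> const_polys \<noteq> {} \<and> \<not> principal_ideal H P}"
    and eq: "ideal_class H P = ideal_class H P'"
  have "P \<in> prime_of ` Inl ` (SIGMA p:fixed_primes. facets p)" "P' \<in> prime_of ` Inl ` (SIGMA p:fixed_primes. facets p)"
    using P P' unfolding height_one_primes_const[symmetric] by simp_all
  then obtain p c p' c' where pc: "p \<in> fixed_primes" "c \<in> facets p" "P = prime_of (Inl (p, c))"
    "p' \<in> fixed_primes" "c' \<in> facets p'" "P' = prime_of (Inl (p', c'))" by blast
  have i: "Inl (p, c) \<in> I" "Inl (p', c') \<in> I" using pc by blast+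
  obtain x where x: "x \<in> L" "\<forall>k\<in>I. unit_vec (Inl (p, c)) k = \<phi> k x + unit_vec (Inl (p', c')) k"
    using ideal_class_eqD[OF i] eq pc by blast
  define a where "a = (\<lambda>k. unit_vec (Inl (p, c)) k - unit_vec (Inl (p', c')) k)"
  have "\<forall>k\<in>I. a k = \<phi> k x" using x(2) by (simp add: a_def)
  then obtain m where m: "\<forall>p\<in>fixed_primes. \<forall>c\<in>facets p. a (Inl (p, c)) = m p + lin a p c"
    using principal_vector_iff[of a] x(1) by blast
  have "lin a p d = 0" for d unfolding lin_def a_def by simp
  hence const: "a (Inl (p, d)) = a (Inl (p, c))" if "d \<in> facets p" for d using m pc that by simp
  show "P = P'"
  proof (rule ccontr)
    assume "P \<noteq> P'"
    hence ne: "(p, c) \<noteq> (p', c')" using pc by auto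
    show False
    proof (cases "p = p'")
      case True
      thus False using const[of c'] pc ne by (simp add: a_def)
    next
      case False
      have "d = c" if "d \<in> facets p" for d
        using const[OF that] False by (simp add: a_def split: if_splits)
      hence "facets p = {c}" using pc(2) by blast
      hence "principal_ideal H (prime_of (Inl (p, c)))"
        unfolding principal_prime_of_iff[OF i(1)] using unit_vec_const[OF pc(1)] const_fixed_primes_in_H[OF pc(1)] by blast
      thus False using P pc by blast
    qed
  qed
qed

subsection \<open>Fixed divisors\<close>

definition \<delta> :: "'a \<Rightarrow> 'a fract poly \<Rightarrow> nat" where
  "\<delta> p g = Min ((\<lambda>c. v (Inl (p, c)) g) ` facets p)"

lemma ev_nonzero:
  assumes "g \<in> H" "c \<in> nonroots"
  shows "ev g c \<noteq> 0"
proof -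
  obtain \<kappa> k where g: "\<kappa> \<noteq> 0" "g = monomial \<kappa> k" using monadicE[OF assms(1)] by blast
  have "poly g (to_fract c) \<noteq> 0" unfolding g(2) poly_monomial using g(1) factor_eval_nonzero assms(2) by simp
  thus ?thesis using to_fract_ev[OF monadic_int_valued[OF assms(1)], of c] by auto
qed

lemma \<delta>_le:
  assumes "g \<in> H" "p \<in> fixed_primes" "c \<in> nonroots"
  shows "\<delta> p g \<le> multiplicity p (ev g c)"
proof -
  obtain \<kappa> k where g: "\<kappa> \<noteq> 0" "g = monomial \<kappa> k" using monadicE[OF assms(1)] by blast
  obtain d where d: "d \<in> facets p" "weight p k d \<le> weight p k c" using facets(4) assms by blast
  have int: "monomial \<kappa> k \<in> int_valued" using monadic_int_valued[OF assms(1)] g by simp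
  have "d \<in> nonroots" using d facets(1) assms(2) by blast
  hence "int (v (Inl (p, d)) g) \<le> int (v (Inl (p, c)) g)"
    unfolding g(2) using v_Inl[OF int g(1) _ prime_fixed_primes[OF assms(2)]] assms(3) d(2) by simp
  moreover have "\<delta> p g \<le> v (Inl (p, d)) g"
    unfolding \<delta>_def using d(1) facets(2)[OF assms(2)] by (intro Min_le) auto
  ultimately show ?thesis by (simp add: v_def)
qed

text \<open>The facets attain the minimum over the nonroots. What remains is that a root of f cannot
  give a smaller value.\<close>

lemma min_valuation_fixed_primes:
  assumes g: "g \<in> H" and p: "p \<in> fixed_primes"
  shows "min_valuation p g = enat (\<delta> p g)"
proof (rule antisym)
  have "\<delta> p g \<in> (\<lambda>c. v (Inl (p, c)) g) ` facets p"
    unfolding \<delta>_def using facets(2,3)[OF p] by (intro Min_in) auto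
  then obtain c where c: "c \<in> facets p" "\<delta> p g = multiplicity p (ev g c)" by (auto simp: v_def)
  hence "ev g c \<noteq> 0" using ev_nonzero g facets(1)[OF p] by blast
  hence "valuation p (ev g c) = enat (\<delta> p g)" using c by (simp add: valuation_def)
  thus "min_valuation p g \<le> enat (\<delta> p g)"
    unfolding min_valuation_def ev_def[symmetric] by (metis INF_lower UNIV_I)
next
  \<comment> \<open>This quotient is integral on \<open>nonroots\<close>, hence integer-valued, so
    the power of p divides the values at the roots of f too.\<close>
  define g' where "g' = smult (inverse (to_fract (p ^ \<delta> p g))) g"
  have p0: "p ^ \<delta> p g \<noteq> 0" using fixed_primes_nonzero[OF p] by simp
  have "g' \<in> int_valued"
  proof (rule int_valuedI)
    fix c assume c: "c \<in> nonroots"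
    obtain x where "ev g c = p ^ \<delta> p g * x" using multiplicity_dvd'[OF \<delta>_le[OF g p c]] by (elim dvdE)
    hence "poly g (to_fract c) = to_fract (p ^ \<delta> p g) * to_fract x"
      using to_fract_ev[OF monadic_int_valued[OF g], of c] by simp
    hence "poly g' (to_fract c) = to_fract x" using p0 unfolding g'_def by simp
    thus "poly g' (to_fract c) \<in> range to_fract" by blast
  qed
  have "enat (\<delta> p g) \<le> valuation p (ev g c)" for c
  proof (cases "ev g c = 0")
    case False
    have "to_fract (ev g c) = to_fract (p ^ \<delta> p g) * poly g' (to_fract c)"
      using to_fract_ev[OF monadic_int_valued[OF g], of c] p0 by (simp add: g'_def)
    also have "\<dots> = to_fract (p ^ \<delta> p g * ev g' c)" using to_fract_ev[OF \<open>g' \<in> int_valued\<close>] by simp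
    finally have "p ^ \<delta> p g dvd ev g c" by (simp only: to_fract_eq_iff) simp
    hence "\<delta> p g \<le> multiplicity p (ev g c)"
      using False prime_fixed_primes[OF p] prime_elem_not_unit by (intro multiplicity_geI) auto
    thus ?thesis using False by (simp add: valuation_def)
  qed (simp add: valuation_def)
  thus "enat (\<delta> p g) \<le> min_valuation p g"
    unfolding min_valuation_def ev_def[symmetric] by (intro INF_greatest) simp
qed

lemma min_valuation_not_fixed_primes:
  assumes g: "g \<in> H" and p: "p \<in> Q - fixed_primes"
  shows "min_valuation p g = 0"
proof -
  obtain \<kappa> k where *: "\<kappa> \<noteq> 0" "g = monomial \<kappa> k" "\<And>p. p \<in> Q - fixed_primes \<Longrightarrow> fract_val p \<kappa> = 0" using monadicE[OF g] by blast
  obtain c where c: "c \<in> nonroots" "\<And>k. weight p k c = 0" using Q_witness[OF p] by blast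
  have "int (v (Inl (p, c)) g) = 0"
    unfolding *(2) using v_Inl[of \<kappa> k c p] monadic_int_valued[OF g] * c p prime_Q by auto
  hence "valuation p (ev g c) = 0"
    using ev_nonzero[OF g c(1)] by (simp add: valuation_def v_def zero_enat_def)
  hence "min_valuation p g \<le> 0"
    unfolding min_valuation_def ev_def[symmetric] by (metis INF_lower UNIV_I)
  thus ?thesis by simp
qed

lemma fixed_divisor_eq:
  assumes "g \<in> H"
  shows "fixed_divisor Q g = (\<Prod>p\<in>fixed_primes. p ^ \<delta> p g)"
proof -
  have "{p \<in> Q. min_valuation p g \<noteq> 0} \<subseteq> fixed_primes" using min_valuation_not_fixed_primes[OF assms] by blast
  moreover have "p ^ the_enat (min_valuation p g) = 1" if "p \<in> fixed_primes - {p \<in> Q. min_valuation p g \<noteq> 0}" for p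
    using that fixed_primes_Q by (auto simp: zero_enat_def)
  ultimately have "fixed_divisor Q g = (\<Prod>p\<in>fixed_primes. p ^ the_enat (min_valuation p g))"
    unfolding fixed_divisor_def by (intro prod.mono_neutral_left) auto
  also have "\<dots> = (\<Prod>p\<in>fixed_primes. p ^ \<delta> p g)" using min_valuation_fixed_primes[OF assms] by (intro prod.cong) auto
  finally show ?thesis .
qed

text \<open>Fixed primes are pairwise non-associated, so the exponents can be recovered from the
  product by multiplicities.\<close>

lemma fixed_divisor_mult_iff:
  assumes "g \<in> H" "h \<in> H"
  shows "fixed_divisor Q (g * h) = fixed_divisor Q g * fixed_divisor Q h \<longleftrightarrow>
    (\<forall>p\<in>fixed_primes. \<delta> p (g * h) = \<delta> p g + \<delta> p h)"
proof -
  have eq: "fixed_divisor Q g * fixed_divisor Q h = (\<Prod>p\<in>fixed_primes. p ^ (\<delta> p g + \<delta> p h))"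
    using assms by (simp add: fixed_divisor_eq power_add prod.distrib)
  show ?thesis unfolding eq fixed_divisor_eq[OF mult_in[OF assms]]
  proof
    assume *: "(\<Prod>p\<in>fixed_primes. p ^ \<delta> p (g * h)) = (\<Prod>p\<in>fixed_primes. p ^ (\<delta> p g + \<delta> p h))"
    show "\<forall>p\<in>fixed_primes. \<delta> p (g * h) = \<delta> p g + \<delta> p h"
    proof
      fix p assume p: "p \<in> fixed_primes"
      from arg_cong[OF *, of "multiplicity p"] show "\<delta> p (g * h) = \<delta> p g + \<delta> p h"
        using p unfolding multiplicity_prod_fixed_primes[OF fixed_primes_Q[OF p]] by simp
    qed
  qed simp
qed

text \<open>Given two facets of p, take x lying only on the one and y only on the other. Both have
  minimum 0 over the facets of p, but their product is positive on each of them.\<close>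

lemma fixed_divisor_multiplicative_iff:
  "(\<forall>g\<in>H. \<forall>h\<in>H. fixed_divisor Q (g * h) = fixed_divisor Q g * fixed_divisor Q h) \<longleftrightarrow> rank = 0"
proof
  assume "rank = 0"
  hence single: "\<And>p. p \<in> fixed_primes \<Longrightarrow> facets p = {base p}" unfolding rank_0_iff by blast
  have "\<delta> p (g * h) = \<delta> p g + \<delta> p h" if "g \<in> H" "h \<in> H" "p \<in> fixed_primes" for g h p
  proof -
    have "Inl (p, base p) \<in> I" using that base by blast
    thus ?thesis using that v_mult unfolding \<delta>_def single[OF that(3)] by simp
  qed
  thus "\<forall>g\<in>H. \<forall>h\<in>H. fixed_divisor Q (g * h) = fixed_divisor Q g * fixed_divisor Q h"
    using fixed_divisor_mult_iff by simp
next
  assume *: "\<forall>g\<in>H. \<forall>h\<in>H. fixed_divisor Q (g * h) = fixed_divisor Q g * fixed_divisor Q h"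
  have "c = base p" if pc: "p \<in> fixed_primes" "c \<in> facets p" for p c
  proof (rule ccontr)
    assume ne: "c \<noteq> base p"
    have i: "Inl (p, c) \<in> I" "Inl (p, base p) \<in> I" using pc base by blast+
    obtain x where x: "x \<in> H" "v (Inl (p, c)) x = 0" "\<forall>j\<in>I - {Inl (p, c)}. v j x > 0"
      using v_facet[OF i(1)] by blast
    obtain y where y: "y \<in> H" "v (Inl (p, base p)) y = 0" "\<forall>j\<in>I - {Inl (p, base p)}. v j y > 0"
      using v_facet[OF i(2)] by blast
    note fin = facets(2)[OF pc(1)]
    have "\<delta> p x \<le> v (Inl (p, c)) x" unfolding \<delta>_def using fin pc by (intro Min_le) auto
    moreover have "\<delta> p y \<le> v (Inl (p, base p)) y" unfolding \<delta>_def using fin pc base by (intro Min_le) auto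
    ultimately have "\<delta> p (x * y) = 0"
      using * fixed_divisor_mult_iff[OF x(1) y(1)] x y pc(1) by simp
    moreover have "\<delta> p (x * y) \<in> (\<lambda>d. v (Inl (p, d)) (x * y)) ` facets p"
      unfolding \<delta>_def using fin pc by (intro Min_in) auto
    ultimately obtain d where d: "d \<in> facets p" "v (Inl (p, d)) (x * y) = 0" by auto
    have dI: "Inl (p, d) \<in> I" using d pc by blast
    hence "v (Inl (p, d)) x = 0" "v (Inl (p, d)) y = 0"
      using d(2) v_mult[OF dI x(1) y(1)] by simp_all
    hence "Inl (p, d) = (Inl (p, c) :: ('a \<times> 'a) + 'a poly)" "Inl (p, d) = (Inl (p, base p) :: ('a \<times> 'a) + 'a poly)"
      using x(3) y(3) dI by (metis DiffI less_irrefl singletonD)+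
    thus False using ne by simp
  qed
  thus "rank = 0" unfolding rank_0_iff using base by blast
qed

end

theorem theorem4p1:
  fixes f :: "'a::{factorial_semiring, idom} poly"
    and Q :: "'a set"
    and H :: "'a fract poly set"
    and r :: int
  assumes "f \<noteq> 0"
    and "prime_representatives Q"
    and "H = monadic (fract_poly f)"
    and "r = int (card {P \<in> height_one_primes H. P \<inter> const_polys \<noteq> {}})
           - int (card {u *o H | u. u \<in> atoms H \<inter> const_polys})"
  shows "finite (height_one_primes H) \<and> finite {u *o H | u. u \<in> atoms H \<inter> const_polys} \<and>
    r \<ge> 0 \<and> class_group H \<cong> int_power_group (nat r) \<and>
    card {ideal_class H P | P. P \<in> height_one_primes H}
      \<ge> card {P \<in> height_one_primes H. P \<inter> const_polys \<noteq> {} \<and> \<not> principal_ideal H P} \<and>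
    (factorial H \<longleftrightarrow> finite (carrier (class_group H))) \<and>
    (finite (carrier (class_group H)) \<longleftrightarrow>
       (\<forall>g \<in> H. \<forall>h \<in> H. fixed_divisor Q (g * h) = fixed_divisor Q g * fixed_divisor Q h))"
proof -
  obtain c A where A: "c \<noteq> 0" "f = smult c (prod_mset A)" "\<forall>q\<in>#A. prime_elem (fract_poly q)"
    "\<forall>q\<in>#A. \<forall>q'\<in>#A. fract_poly q dvd fract_poly q' \<longrightarrow> q = q'"
    using primitive_factorization[OF assms(1)] by blast
  interpret F: factored_polynomial c A Q
    by unfold_locales (use A assms(2) in auto)
  have H: "H = monadic (fract_poly F.f)" using assms(3) A(2) F.f_def by simp
  have fin: "finite (height_one_primes H)"
    unfolding H F.height_one_primes_eq by (intro finite_imageI F.finite_I)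
  \<comment> \<open>The height-one primes meeting R are counted by the facets of all fixed primes,
    the constant atoms up to units by the fixed primes themselves.\<close>
  have r: "r = int F.rank"
    unfolding assms(4) H F.card_height_one_primes_const F.card_atoms_const F.rank_eq ..
  have "card {P \<in> height_one_primes H. P \<inter> const_polys \<noteq> {} \<and> \<not> principal_ideal H P}
      \<le> card {ideal_class H P | P. P \<in> height_one_primes H}"
    by (rule card_inj_on_le[OF F.inj_ideal_class_nonprincipal[folded H]]) (use fin in auto)
  moreover have "finite {u *o H | u. u \<in> atoms H \<inter> const_polys}"
    unfolding H F.atoms_const by simp
  ultimately show ?thesis
    using fin F.class_group_iso_int_power F.finite_class_group_iff F.factorial_iff_rank
      F.fixed_divisor_multiplicative_iff
    unfolding r H by simp
qed

end
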